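(* Let $(W,S)$ be a simply laced Coxeter system with $S$ finite and Coxeter graph $\Gamma=(V,E)$, and let $f:E\to\{+1,-1\}$ be an assignment of signs to the edges, so that $\Gamma_f=(V,E,f)$ is a signed Coxeter graph. Then the representation $\mathcal{R}_{\Gamma,f}$ of $W$ is faithful if and only if $\Gamma_f$ is balanced, i.e., the product of the signs along any cycle of $\Gamma$ is $+1$ (equivalently, every cycle has an even number of edges with sign $-1$).
   Context: A Coxeter system $(W,S)$ with $S=\{s_1,\dots,s_N\}$ finite is a group $W$ generated by $S$ with defining relations $s_i^2=1$ and $(s_is_j)^{m_{ij}}=1$ for $i\ne j$, where $m_{ij}=m_{ji}\in\{2,3,\dots\}\cup\{\infty\}$ ($m_{ij}=\infty$ means no relation between $s_i$ and $s_j$). It is simply laced if $m_{ij}\in\{2,3\}$ for all $i\neq j$. The Coxeter graph $\Gamma=(V,E)$ has vertex set $V=S$, with $s_i,s_j$ ($i\ne j$) joined by an edge exactly when $m_{ij}\ge 3$. For a simply laced system and signs $f:E\to\{+1,-1\}$, put $f((s_i,s_j))=f((s_j,s_i))=f(\{s_i,s_j\})$. The signed Coxeter graph $\Gamma_f=(V,E,f)$ is balanced if the weight of every closed path (the product of the signs of the edges of which it consists) equals $1$. Representation $\mathcal{R}_{\Gamma,f}$: the generator $s_i$ is sent to the $N\times N$ complex matrix $\omega_i$ that differs from the identity matrix only in its $i$-th row; this row has $-1$ in position $(i,i)$, has $f((s_i,s_j))\cdot 2\cos(\pi/3)=f((s_i,s_j))$ in position $(i,j)$ when $s_i$ and $s_j$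 are joined by an edge, and $0$ in position $(i,j)$ when $i\neq j$ and $s_i,s_j$ are not joined. The assignment $s_i\mapsto\omega_i$ extends to a group homomorphism $\mathcal{R}_{\Gamma,f}:W\to GL_N(\mathbb{C})$. Faithful means that this homomorphism is injective. *)

theory Defs
  imports
    "HOL-Library.Extended_Nat"
    "HOL-Algebra.Generated_Groups"
    "Graph_Theory.Graph_Theory"
    "Jordan_Normal_Form.Matrix"
begin

section \<open>Group presentations\<close>

text \<open>
  A word over \<open>S\<close> is a list of letters; the letter \<open>(x, True)\<close> stands for the generator \<open>x\<close> and
  \<open>(x, False)\<close> for its formal inverse.
\<close>

type_synonym 'a gword = "('a \<times> bool) list"

definition gwords :: "'a set \<Rightarrow> 'a gword set" where
  "gwords S = lists (S \<times> UNIV)"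

text \<open>The value in \<open>G\<close> of a word, each generator \<open>x\<close> being interpreted as \<open>\<phi> x\<close>.\<close>

definition word_eval :: "('g, 'm) monoid_scheme \<Rightarrow> ('a \<Rightarrow> 'g) \<Rightarrow> 'a gword \<Rightarrow> 'g" where
  "word_eval G \<phi> w =
     foldr (\<lambda>(x, b) g. (if b then \<phi> x else inv\<^bsub>G\<^esub> (\<phi> x)) \<otimes>\<^bsub>G\<^esub> g) w \<one>\<^bsub>G\<^esub>"

text \<open>
  The congruence on words whose classes are the elements of the group with generators \<open>S\<close> and
  defining relations \<open>r = 1\<close> for \<open>r \<in> R\<close>.
\<close>

inductive word_equiv :: "'a set \<Rightarrow> 'a gword set \<Rightarrow> 'a gword \<Rightarrow> 'a gword \<Rightarrow> bool"
  for S :: "'a set" and R :: "'a gword set" where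
  refl: "u \<in> gwords S \<Longrightarrow> word_equiv S R u u"
| sym: "word_equiv S R u v \<Longrightarrow> word_equiv S R v u"
| trans: "word_equiv S R u v \<Longrightarrow> word_equiv S R v w \<Longrightarrow> word_equiv S R u w"
| cancel: "u \<in> gwords S \<Longrightarrow> v \<in> gwords S \<Longrightarrow> x \<in> S \<Longrightarrow>
    word_equiv S R (u @ [(x, b), (x, \<not> b)] @ v) (u @ v)"
| relator: "u \<in> gwords S \<Longrightarrow> v \<in> gwords S \<Longrightarrow> r \<in> R \<Longrightarrow> word_equiv S R (u @ r @ v) (u @ v)"

text \<open>
  \<open>G\<close> is generated by its subset \<open>S\<close>, with defining relations \<open>r = 1\<close> for \<open>r \<in> R\<close>: two words have
  the same value in \<open>G\<close> exactly when this is a formal consequence of the relations.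
\<close>

definition group_presentation ::
  "('a, 'm) monoid_scheme \<Rightarrow> 'a set \<Rightarrow> 'a gword set \<Rightarrow> bool" where
  "group_presentation G S R \<longleftrightarrow>
     group G \<and> S \<subseteq> carrier G \<and> generate G S = carrier G \<and> R \<subseteq> gwords S \<and>
     (\<forall>u\<in>gwords S. \<forall>v\<in>gwords S.
        word_eval G (\<lambda>x. x) u = word_eval G (\<lambda>x. x) v \<longleftrightarrow> word_equiv S R u v)"


section \<open>Coxeter systems\<close>

text \<open>Only the values \<open>m x y\<close> with \<open>x \<noteq> y\<close> matter; \<open>m x y = \<infinity>\<close> contributes no relator.\<close>

definition coxeter_relators :: "'a set \<Rightarrow> ('a \<Rightarrow> 'a \<Rightarrow> enat) \<Rightarrow> 'a gword set" where
  "coxeter_relators S m =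
     {[(x, True), (x, True)] |x. x \<in> S} \<union>
     {concat (replicate n [(x, True), (y, True)]) |x y n.
        x \<in> S \<and> y \<in> S \<and> x \<noteq> y \<and> m x y = enat n}"

definition coxeter_system ::
  "('a, 'm) monoid_scheme \<Rightarrow> 'a set \<Rightarrow> ('a \<Rightarrow> 'a \<Rightarrow> enat) \<Rightarrow> bool" where
  "coxeter_system W S m \<longleftrightarrow>
     finite S \<and>
     (\<forall>x\<in>S. \<forall>y\<in>S. x \<noteq> y \<longrightarrow> m x y = m y x \<and> 2 \<le> m x y) \<and>
     group_presentation W S (coxeter_relators S m)"

definition simply_laced :: "'a set \<Rightarrow> ('a \<Rightarrow> 'a \<Rightarrow> enat) \<Rightarrow> bool" where
  "simply_laced S m \<longleftrightarrow> (\<forall>x\<in>S. \<forall>y\<in>S. x \<noteq> y \<longrightarrow> m x y \<in> {2, 3})"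


section \<open>Signed Coxeter graphs\<close>

definition coxeter_edges :: "'a set \<Rightarrow> ('a \<Rightarrow> 'a \<Rightarrow> enat) \<Rightarrow> 'a set set" where
  "coxeter_edges S m = {{x, y} |x y. x \<in> S \<and> y \<in> S \<and> x \<noteq> y \<and> 3 \<le> m x y}"

text \<open>The Coxeter graph, each edge \<open>{x, y}\<close> being represented by the two arcs \<open>(x, y)\<close> and \<open>(y, x)\<close>.\<close>

definition coxeter_graph :: "'a set \<Rightarrow> ('a \<Rightarrow> 'a \<Rightarrow> enat) \<Rightarrow> ('a, 'a \<times> 'a) pre_digraph" where
  "coxeter_graph S m =
     \<lparr>verts = S, arcs = {(x, y). {x, y} \<in> coxeter_edges S m}, tail = fst, head = snd\<rparr>"

text \<open>The sign of an edge is a function of the unordered pair of its ends.\<close>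

definition path_weight :: "('a set \<Rightarrow> int) \<Rightarrow> ('a \<times> 'a) list \<Rightarrow> int" where
  "path_weight f p = prod_list (map (\<lambda>(x, y). f {x, y}) p)"

definition balanced :: "('a, 'a \<times> 'a) pre_digraph \<Rightarrow> ('a set \<Rightarrow> int) \<Rightarrow> bool" where
  "balanced \<Gamma> f \<longleftrightarrow> (\<forall>p. wf_digraph.closed_w \<Gamma> p \<longrightarrow> path_weight f p = 1)"

lemma coxeter_edge_iff:
  "{x, y} \<in> coxeter_edges S m \<longleftrightarrow>
    x \<in> S \<and> y \<in> S \<and> x \<noteq> y \<and> (3 \<le> m x y \<or> 3 \<le> m y x)"
  by (auto simp: coxeter_edges_def doubleton_eq_iff)

lemma wf_coxeter_graph: "wf_digraph (coxeter_graph S m)"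
  by unfold_locales (auto simp: coxeter_graph_def coxeter_edge_iff)

text \<open>
  It makes no difference whether closed paths may repeat vertices. The library's \<open>cycle\<close> admits the
  two-arc closed walk along a single edge, which is not a cycle of the undirected graph.
\<close>

lemma balanced_iff_cycles:
  assumes f: "f \<in> coxeter_edges S m \<rightarrow> {1, -1}"
  shows "balanced (coxeter_graph S m) f \<longleftrightarrow>
    (\<forall>p. pre_digraph.cycle (coxeter_graph S m) p \<and> 3 \<le> length p \<longrightarrow> path_weight f p = 1)"
proof -
  interpret wf_digraph "coxeter_graph S m" by (rule wf_coxeter_graph)
  have sel: "arcs (coxeter_graph S m) = {(x, y). {x, y} \<in> coxeter_edges S m}"
    "tail (coxeter_graph S m) = fst" "head (coxeter_graph S m) = snd"
    by (auto simp: coxeter_graph_def)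
  have app: "path_weight f (p @ q) = path_weight f p * path_weight f q" for p q
    by (simp add: path_weight_def)
  have "path_weight f p = 1"
    if cyc: "\<And>p. cycle p \<Longrightarrow> 3 \<le> length p \<Longrightarrow> path_weight f p = 1" and "awalk u p u" for u p
    using \<open>awalk u p u\<close>
  proof (induction p arbitrary: u rule: length_induct)
    case (1 p)
    have IH: "path_weight f q = 1" if "length q < length p" "awalk w q w" for q w
      using 1 that by blast
    show ?case
    proof (cases "p = []")
      case True
      then show ?thesis by (simp add: path_weight_def)
    next
      case ne: False
      show ?thesis
      proof (cases "distinct (tl (awalk_verts u p))")
        case True
        then have c: "cycle p" using ne 1 by (auto simp: cycle_def)
        show ?thesis
        proof (cases "3 \<le> length p")
          case True
          then show ?thesis using c cyc by blast
        next
          case False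
          then consider a where "p = [a]" | a b where "p = [a, b]"
            using ne by (cases p; cases "tl p"; cases "tl (tl p)") auto
          then show ?thesis
          proof cases
            case 1
            then show ?thesis using \<open>awalk u p u\<close>
              by (cases a) (auto simp: awalk_def sel coxeter_edge_iff)
          next
            case 2
            then show ?thesis using \<open>awalk u p u\<close> f
              by (cases a; cases b) (auto simp: awalk_def sel path_weight_def insert_commute Pi_def)
          qed
        qed
      next
        case False
        obtain a p' where p: "p = a # p'" using ne by (cases p) auto
        have aw: "awalk (head (coxeter_graph S m) a) p' u"
          using 1 p by (auto simp: awalk_Cons_iff)
        have "\<not> distinct (awalk_verts (head (coxeter_graph S m) a) p')"
          using False p by simp
        then obtain q r s where d: "p' = q @ r @ s" "\<exists>w. awalk w r w" "r \<noteq> []"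
          using awalk_not_distinct_decomp[OF aw] by (auto simp: closed_w_def)
        then obtain w where w: "awalk w r w" by blast
        have pp: "p = (a # q) @ r @ s" using p d by simp
        have "awalk u (a # q) w \<and> awalk w s u"
          using 1 w d(3) unfolding pp by (metis awalk_append_iff awalk_ends)
        then have "awalk u ((a # q) @ s) u" by (metis awalk_appendI)
        then have "path_weight f ((a # q) @ s) = 1" using IH d(3) pp by auto
        moreover have "path_weight f r = 1" using IH[OF _ w] pp by simp
        ultimately show ?thesis unfolding pp app by simp
      qed
    qed
  qed
  then show ?thesis by (auto simp: balanced_def closed_w_def cycle_def)
qed


section \<open>The representation attached to a signed Coxeter graph\<close>

definition GL :: "nat \<Rightarrow> complex mat monoid" where
  "GL n = units_of (ring_mat TYPE(complex) n ())"

text \<open>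
  \<open>s\<close> enumerates \<open>S\<close>, with indices starting from \<open>0\<close>. For an edge the off-diagonal entry is
  \<open>f {s i, s j} * 2 * cos (pi / 3) = f {s i, s j}\<close>.
\<close>

definition signed_gen ::
  "'a set \<Rightarrow> ('a \<Rightarrow> 'a \<Rightarrow> enat) \<Rightarrow> (nat \<Rightarrow> 'a) \<Rightarrow> ('a set \<Rightarrow> int) \<Rightarrow> nat \<Rightarrow> complex mat" where
  "signed_gen S m s f i =
     mat (card S) (card S) (\<lambda>(k, j).
       if k \<noteq> i then (if k = j then 1 else 0)
       else if j = i then -1
       else if {s i, s j} \<in> coxeter_edges S m then of_int (f {s i, s j})
       else 0)"

text \<open>
  The homomorphism extending \<open>s i \<mapsto> signed_gen S m s f i\<close>; \<open>extensional\<close> makes it unique as a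
  function on the whole type. That it exists is shown in \<open>signed_rep\<close> below.
\<close>

definition signed_rep ::
  "('a, 'm) monoid_scheme \<Rightarrow> 'a set \<Rightarrow> ('a \<Rightarrow> 'a \<Rightarrow> enat) \<Rightarrow> (nat \<Rightarrow> 'a) \<Rightarrow> ('a set \<Rightarrow> int) \<Rightarrow>
    'a \<Rightarrow> complex mat" where
  "signed_rep W S m s f =
     (THE \<rho>. \<rho> \<in> extensional (carrier W) \<and> \<rho> \<in> hom W (GL (card S)) \<and>
        (\<forall>i<card S. \<rho> (s i) = signed_gen S m s f i))"

subsection \<open>Homomorphisms out of a presented group\<close>

lemma gwords_simps [simp]:
  "[] \<in> gwords S" "a # w \<in> gwords S \<longleftrightarrow> fst a \<in> S \<and> w \<in> gwords S"
  "u @ v \<in> gwords S \<longleftrightarrow> u \<in> gwords S \<and> v \<in> gwords S"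
  by (cases a; auto simp: gwords_def)+

lemma word_eval_simps [simp]:
  "word_eval G \<phi> [] = \<one>\<^bsub>G\<^esub>"
  "word_eval G \<phi> ((x, b) # w) =
     (if b then \<phi> x else inv\<^bsub>G\<^esub> (\<phi> x)) \<otimes>\<^bsub>G\<^esub> word_eval G \<phi> w"
  by (simp_all add: word_eval_def)

context group
begin

lemma word_eval_closed [simp]:
  "\<phi> \<in> S \<rightarrow> carrier G \<Longrightarrow> w \<in> gwords S \<Longrightarrow> word_eval G \<phi> w \<in> carrier G"
  by (induction w) (auto simp: Pi_def)

lemma word_eval_append:
  "\<phi> \<in> S \<rightarrow> carrier G \<Longrightarrow> u \<in> gwords S \<Longrightarrow> v \<in> gwords S \<Longrightarrow>
    word_eval G \<phi> (u @ v) = word_eval G \<phi> u \<otimes> word_eval G \<phi> v"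
proof (induction u)
  case (Cons a u)
  then have "\<phi> (fst a) \<in> carrier G" by auto
  with Cons show ?case
    by (cases a) (auto simp: m_assoc word_eval_closed[OF Cons.prems(1)])
qed simp

lemma word_equiv_eval:
  assumes \<phi>: "\<phi> \<in> S \<rightarrow> carrier G" and R: "R \<subseteq> gwords S"
    and rel: "\<And>r. r \<in> R \<Longrightarrow> word_eval G \<phi> r = \<one>"
  shows "word_equiv S R u v \<Longrightarrow>
    u \<in> gwords S \<and> v \<in> gwords S \<and> word_eval G \<phi> u = word_eval G \<phi> v"
proof (induction rule: word_equiv.induct)
  case (cancel u v x b)
  then have "\<phi> x \<in> carrier G" using \<phi> by auto
  then have "word_eval G \<phi> ([(x, b), (x, \<not> b)] @ v) = word_eval G \<phi> v"
    using cancel by (auto simp: m_assoc[symmetric] word_eval_closed[OF \<phi>])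
  with cancel show ?case by (simp add: word_eval_append[OF \<phi>] del: word_eval_simps)
next
  case (relator u v r)
  then have "r \<in> gwords S" using R by auto
  with relator show ?case
    by (simp add: word_eval_append[OF \<phi>] word_eval_closed[OF \<phi>] rel)
qed auto

lemma word_eval_surj:
  assumes S: "S \<subseteq> carrier G" and "x \<in> generate G S"
  shows "\<exists>u\<in>gwords S. word_eval G (\<lambda>x. x) u = x"
  using assms(2)
proof induction
  case one
  show ?case by (intro bexI[of _ "[]"]) auto
next
  case (incl h)
  then show ?case using S by (intro bexI[of _ "[(h, True)]"]) auto
next
  case (inv h)
  then show ?case using S by (intro bexI[of _ "[(h, False)]"]) auto
next
  case (eng h1 h2)
  then obtain u v where "u \<in> gwords S" "v \<in> gwords S"
    "word_eval G (\<lambda>x. x) u = h1" "word_eval G (\<lambda>x. x) v = h2" by auto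
  moreover have "(\<lambda>x. x) \<in> S \<rightarrow> carrier G" using S by auto
  ultimately show ?case by (intro bexI[of _ "u @ v"]) (auto simp: word_eval_append)
qed

lemma hom_word_eval:
  assumes H: "group H" and \<rho>: "\<rho> \<in> hom G H" and S: "S \<subseteq> carrier G" and w: "w \<in> gwords S"
  shows "\<rho> (word_eval G (\<lambda>x. x) w) = word_eval H \<rho> w"
proof -
  have id: "(\<lambda>x. x) \<in> S \<rightarrow> carrier G" using S by auto
  note closed = word_eval_closed[OF id]
  interpret group_hom G H \<rho>
    using H \<rho> by (intro group_hom.intro group_hom_axioms.intro) (auto simp: is_group)
  show ?thesis using w
  proof (induction w)
    case (Cons a w)
    then have "fst a \<in> carrier G" "word_eval G (\<lambda>x. x) w \<in> carrier G"
      using S closed by auto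
    with Cons show ?case by (cases a) auto
  qed simp
qed

end

lemma presentation_hom:
  assumes pres: "group_presentation G S R" and H: "group H"
    and \<phi>: "\<phi> \<in> S \<rightarrow> carrier H" and rel: "\<And>r. r \<in> R \<Longrightarrow> word_eval H \<phi> r = \<one>\<^bsub>H\<^esub>"
  shows "\<exists>!\<rho>. \<rho> \<in> extensional (carrier G) \<and> \<rho> \<in> hom G H \<and> (\<forall>x\<in>S. \<rho> x = \<phi> x)"
proof -
  interpret G: group G using pres by (simp add: group_presentation_def)
  interpret H: group H by (rule H)
  have S: "S \<subseteq> carrier G" and gen: "generate G S = carrier G" and R: "R \<subseteq> gwords S"
    and eq: "\<And>u v. u \<in> gwords S \<Longrightarrow> v \<in> gwords S \<Longrightarrow>
      word_eval G (\<lambda>x. x) u = word_eval G (\<lambda>x. x) v \<Longrightarrow> word_equiv S R u v"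
    using pres by (auto simp: group_presentation_def)
  have id: "(\<lambda>x. x) \<in> S \<rightarrow> carrier G" using S by auto
  define c where "c x = (SOME u. u \<in> gwords S \<and> word_eval G (\<lambda>x. x) u = x)" for x
  have c: "c x \<in> gwords S" "word_eval G (\<lambda>x. x) (c x) = x" if "x \<in> carrier G" for x
    using someI_ex[of "\<lambda>u. u \<in> gwords S \<and> word_eval G (\<lambda>x. x) u = x"]
      G.word_eval_surj[OF S, of x] that gen by (auto simp: c_def)
  define \<rho> where "\<rho> = restrict (\<lambda>x. word_eval H \<phi> (c x)) (carrier G)"
  have \<rho>: "\<rho> (word_eval G (\<lambda>x. x) u) = word_eval H \<phi> u" if u: "u \<in> gwords S" for u
  proof -
    let ?x = "word_eval G (\<lambda>x. x) u"
    have x: "?x \<in> carrier G" using G.word_eval_closed[OF id u] .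
    have "word_equiv S R (c ?x) u" using eq c[OF x] u by auto
    from H.word_equiv_eval[OF \<phi> R rel this] show ?thesis using x by (simp add: \<rho>_def)
  qed
  have gens: "\<rho> x = \<phi> x" if "x \<in> S" for x
  proof -
    have "x \<in> carrier G" "\<phi> x \<in> carrier H" using that S \<phi> by auto
    then show ?thesis using \<rho>[of "[(x, True)]"] that by simp
  qed
  have "\<rho> \<in> hom G H"
  proof (rule homI)
    fix x assume "x \<in> carrier G"
    then show "\<rho> x \<in> carrier H" using c H.word_eval_closed[OF \<phi>] by (simp add: \<rho>_def)
  next
    fix x y assume xy: "x \<in> carrier G" "y \<in> carrier G"
    have "\<rho> (x \<otimes>\<^bsub>G\<^esub> y) = \<rho> (word_eval G (\<lambda>x. x) (c x @ c y))"
      using c xy G.word_eval_append[OF id] by simp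
    also have "\<dots> = word_eval H \<phi> (c x @ c y)" using \<rho> c xy by simp
    also have "\<dots> = \<rho> x \<otimes>\<^bsub>H\<^esub> \<rho> y"
      using c xy H.word_eval_append[OF \<phi>] by (simp add: \<rho>_def)
    finally show "\<rho> (x \<otimes>\<^bsub>G\<^esub> y) = \<rho> x \<otimes>\<^bsub>H\<^esub> \<rho> y" .
  qed
  show ?thesis
  proof (rule ex1I[of _ \<rho>])
    show "\<rho> \<in> extensional (carrier G) \<and> \<rho> \<in> hom G H \<and> (\<forall>x\<in>S. \<rho> x = \<phi> x)"
      using \<open>\<rho> \<in> hom G H\<close> gens by (auto simp: \<rho>_def)
  next
    fix \<sigma> assume \<sigma>: "\<sigma> \<in> extensional (carrier G) \<and> \<sigma> \<in> hom G H \<and> (\<forall>x\<in>S. \<sigma> x = \<phi> x)"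
    have ev: "word_eval H \<sigma> u = word_eval H \<phi> u" if "u \<in> gwords S" for u
      using that \<sigma> by (induction u) auto
    show "\<sigma> = \<rho>"
    proof (rule extensionalityI[of _ "carrier G"])
      fix x assume x: "x \<in> carrier G"
      then show "\<sigma> x = \<rho> x"
        using G.hom_word_eval[OF H _ S c(1)[OF x], of \<sigma>] \<sigma> c[OF x] ev[of "c x"] by (simp add: \<rho>_def)
    qed (use \<sigma> in \<open>auto simp: \<rho>_def\<close>)
  qed
qed

subsection \<open>Existence of the representation\<close>

lemma GL_simps:
  "group (GL n)" "carrier (GL n) = Units (ring_mat TYPE(complex) n ())"
  "x \<otimes>\<^bsub>GL n\<^esub> y = x * y" "\<one>\<^bsub>GL n\<^esub> = 1\<^sub>m n"
proof -
  interpret ring "ring_mat TYPE(complex) n ()" by (rule ring_mat)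
  show "group (GL n)" unfolding GL_def by (rule units_group)
qed (auto simp: GL_def units_of_def ring_mat_def)

text \<open>The action of \<open>signed_gen\<close> on column vectors, written as functions on indices.\<close>

definition srow :: "nat \<Rightarrow> (nat \<Rightarrow> nat \<Rightarrow> complex) \<Rightarrow> nat \<Rightarrow> (nat \<Rightarrow> complex) \<Rightarrow> complex" where
  "srow n a i v = (\<Sum>j<n. a i j * v j)"

definition sact :: "nat \<Rightarrow> (nat \<Rightarrow> nat \<Rightarrow> complex) \<Rightarrow> nat \<Rightarrow> (nat \<Rightarrow> complex) \<Rightarrow> nat \<Rightarrow> complex" where
  "sact n a i v = v(i := srow n a i v - v i)"

lemma srow_upd:
  assumes "j < n"
  shows "srow n a i (v(j := x)) = srow n a i v + a i j * (x - v j)"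
proof -
  have "srow n a i (v(j := x)) = a i j * x + (\<Sum>k\<in>{..<n} - {j}. a i k * v k)"
    using assms by (simp add: srow_def sum.remove[of _ j])
  moreover have "srow n a i v = a i j * v j + (\<Sum>k\<in>{..<n} - {j}. a i k * v k)"
    using assms by (simp add: srow_def sum.remove[of _ j])
  ultimately show ?thesis by (simp add: algebra_simps)
qed

lemma sact_square:
  "i < n \<Longrightarrow> a i i = 0 \<Longrightarrow> sact n a i (sact n a i v) = v"
  by (simp add: sact_def srow_upd)

lemma sact_commute:
  assumes "i < n" "j < n" "i \<noteq> j" "a i i = 0" "a j j = 0" "a i j = 0" "a j i = 0"
  shows "sact n a i (sact n a j (sact n a i (sact n a j v))) = v"
  using assms by (auto simp: sact_def srow_upd fun_eq_iff)

lemma sact_braid: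
  assumes "i < n" "j < n" "i \<noteq> j" "a i i = 0" "a j j = 0" "a j i = a i j" "a i j * a i j = 1"
  shows "sact n a i (sact n a j (sact n a i (sact n a j (sact n a i (sact n a j v))))) = v"
proof -
  have "a i j = 1 \<or> a i j = -1" using assms(7) by (simp add: square_eq_1_iff)
  then show ?thesis
  proof
    assume "a i j = 1"
    with assms show ?thesis by (simp add: sact_def srow_upd fun_eq_iff)
  next
    assume "a i j = -1"
    with assms show ?thesis by (simp add: sact_def srow_upd fun_eq_iff)
  qed
qed

lemma signed_rep_ex1:
  assumes W: "coxeter_system W S m" and sl: "simply_laced S m"
    and s: "bij_betw s {..<card S} S" and f: "f \<in> coxeter_edges S m \<rightarrow> {1, -1}"
  shows "\<exists>!\<rho>. \<rho> \<in> extensional (carrier W) \<and> \<rho> \<in> hom W (GL (card S)) \<and>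
    (\<forall>i<card S. \<rho> (s i) = signed_gen S m s f i)"
proof -
  define n where "n = card S"
  define a where "a i j = (if {s i, s j} \<in> coxeter_edges S m then of_int (f {s i, s j}) else (0::complex))"
    for i j
  let ?M = "signed_gen S m s f"
  define t where "t = inv_into {..<n} s"
  have t: "t x < n" "s (t x) = x" if "x \<in> S" for x
    using that bij_betw_inv_into_right[OF s] bij_betwE[OF bij_betw_inv_into[OF s]]
    by (auto simp: t_def n_def)
  have ts: "t (s i) = i" "s i \<in> S" if "i < n" for i
    using that bij_betw_inv_into_left[OF s] bij_betwE[OF s] by (auto simp: t_def n_def)
  have noloop: "{x} \<notin> coxeter_edges S m" for x using coxeter_edge_iff[of x x] by simp
  have aii: "a i i = 0" for i by (simp add: a_def noloop)
  have asym: "a j i = a i j" for i j by (simp add: a_def insert_commute)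
  have M: "?M i \<in> carrier_mat n n" for i by (simp add: signed_gen_def n_def)
  have step: "(?M i * A) $$ (k, l) = sact n a i (\<lambda>k. A $$ (k, l)) k"
    if i: "i < n" and A: "A \<in> carrier_mat n n" and k: "k < n" and l: "l < n" for i A k l
  proof -
    have "(?M i * A) $$ (k, l) = (\<Sum>j<n. ?M i $$ (k, j) * A $$ (j, l))"
      using A k l M[of i] by (auto simp: scalar_prod_def atLeast0LessThan)
    also have "\<dots> = sact n a i (\<lambda>k. A $$ (k, l)) k"
    proof (cases "k = i")
      case False
      have "(\<Sum>j<n. ?M i $$ (k, j) * A $$ (j, l)) = (\<Sum>j<n. if j = k then A $$ (j, l) else 0)"
        using False k by (intro sum.cong) (auto simp: signed_gen_def n_def)
      then show ?thesis using False k by (simp add: sact_def)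
    next
      case True
      have "(\<Sum>j<n. ?M i $$ (k, j) * A $$ (j, l)) =
        (\<Sum>j<n. a i j * A $$ (j, l) - (if j = i then A $$ (j, l) else 0))"
        using True k by (intro sum.cong) (auto simp: signed_gen_def n_def a_def noloop)
      then show ?thesis using True k by (simp add: sact_def srow_def sum_subtractf)
    qed
    finally show ?thesis .
  qed
  have cong: "sact n a i v k = sact n a i w k" if "\<And>k. k < n \<Longrightarrow> v k = w k" "k < n" "i < n" for i v w k
    using that by (auto simp: sact_def srow_def)
  have prod: "foldr (\<lambda>i A. ?M i * A) is (1\<^sub>m n) \<in> carrier_mat n n \<and>
      (\<forall>k<n. \<forall>l<n. foldr (\<lambda>i A. ?M i * A) is (1\<^sub>m n) $$ (k, l) =
        foldr (sact n a) is (\<lambda>k. if k = l then 1 else 0) k)"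
    if "set is \<subseteq> {..<n}" for "is"
    using that
  proof (induction "is")
    case (Cons i "is")
    then have i: "i < n" and IH: "foldr (\<lambda>i A. ?M i * A) is (1\<^sub>m n) \<in> carrier_mat n n"
      "\<And>k l. k < n \<Longrightarrow> l < n \<Longrightarrow> foldr (\<lambda>i A. ?M i * A) is (1\<^sub>m n) $$ (k, l) =
        foldr (sact n a) is (\<lambda>k. if k = l then 1 else 0) k" by auto
    have "foldr (\<lambda>i A. ?M i * A) (i # is) (1\<^sub>m n) $$ (k, l) =
        foldr (sact n a) (i # is) (\<lambda>k. if k = l then 1 else 0) k" if "k < n" "l < n" for k l
      using step[OF i IH(1) that] cong[OF IH(2) that(1) i] that(2) by simp
    then show ?case using IH(1) M[of i] by simp
  qed auto
  have one: "foldr (\<lambda>i A. ?M i * A) is (1\<^sub>m n) = 1\<^sub>m n"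
    if "set is \<subseteq> {..<n}" "\<And>v. foldr (sact n a) is v = v" for "is"
    using prod[OF that(1)] that(2) by (intro eq_matI) auto
  have sq: "?M i * ?M i = 1\<^sub>m n" if "i < n" for i
    using one[of "[i, i]"] that M[of i] by (simp add: sact_square aii)
  have MU: "?M i \<in> carrier (GL n)" if "i < n" for i
    using sq[OF that] M[of i] by (auto simp: GL_simps Units_def ring_mat_simps)
  have ev: "word_eval (GL n) (\<lambda>x. ?M (t x)) (map (\<lambda>x. (x, True)) xs) =
      foldr (\<lambda>i A. ?M i * A) (map t xs) (1\<^sub>m n)" for xs
    by (induction xs) (auto simp: GL_simps)
  have rel: "word_eval (GL n) (\<lambda>x. ?M (t x)) r = \<one>\<^bsub>GL n\<^esub>" if "r \<in> coxeter_relators S m" for r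
  proof -
    have "\<exists>xs. set xs \<subseteq> S \<and> r = map (\<lambda>x. (x, True)) xs \<and> (\<forall>v. foldr (sact n a) (map t xs) v = v)"
      using that unfolding coxeter_relators_def
    proof (elim UnE CollectE exE conjE)
      fix x assume "r = [(x, True), (x, True)]" "x \<in> S"
      then show ?thesis by (intro exI[of _ "[x, x]"]) (auto simp: sact_square aii t)
    next
      fix x y k
      assume r: "r = concat (replicate k [(x, True), (y, True)])"
        and xy: "x \<in> S" "y \<in> S" "x \<noteq> y" and k: "m x y = enat k"
      have txy: "t x \<noteq> t y" using t xy by metis
      have sm: "m y x = m x y" using W xy by (simp add: coxeter_system_def)
      have "m x y = 2 \<or> m x y = 3" using sl xy by (simp add: simply_laced_def)
      then show ?thesis
      proof
        assume m: "m x y = 2"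
        then have k2: "k = 2" using k by (simp add: numeral_eq_enat)
        have "a (t x) (t y) = 0" using m sm t xy
          by (simp add: a_def coxeter_edge_iff numeral_eq_enat)
        then show ?thesis using r xy k2 txy t
          by (intro exI[of _ "[x, y, x, y]"]) (auto simp: numeral_eq_Suc sact_commute aii asym[of "t y"])
      next
        assume m: "m x y = 3"
        then have k3: "k = 3" using k by (simp add: numeral_eq_enat)
        have "{x, y} \<in> coxeter_edges S m" using m xy by (simp add: coxeter_edge_iff)
        then have "a (t x) (t y) * a (t x) (t y) = 1" using f xy t
          by (auto simp: a_def Pi_def)
        then show ?thesis using r xy k3 txy t
          by (intro exI[of _ "[x, y, x, y, x, y]"])
            (auto simp: numeral_eq_Suc intro!: sact_braid aii asym)
      qed
    qed
    then obtain xs where "set xs \<subseteq> S" "r = map (\<lambda>x. (x, True)) xs"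
      "\<And>v. foldr (sact n a) (map t xs) v = v" by auto
    moreover from this have "set (map t xs) \<subseteq> {..<n}" using t by auto
    ultimately show ?thesis using one[of "map t xs"] ev by (simp add: GL_simps)
  qed
  have "(\<forall>i<n. \<rho> (s i) = ?M i) \<longleftrightarrow> (\<forall>x\<in>S. \<rho> x = ?M (t x))" for \<rho>
    using t ts by metis
  moreover have "\<exists>!\<rho>. \<rho> \<in> extensional (carrier W) \<and> \<rho> \<in> hom W (GL n) \<and> (\<forall>x\<in>S. \<rho> x = ?M (t x))"
    using W MU t by (intro presentation_hom[OF _ GL_simps(1) _ rel]) (auto simp: coxeter_system_def)
  ultimately show ?thesis by (simp add: n_def)
qed

theorem signed_rep:
  assumes "coxeter_system W S m" "simply_laced S m"
    and "bij_betw s {..<card S} S" "f \<in> coxeter_edges S m \<rightarrow> {1, -1}"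
  shows "signed_rep W S m s f \<in> hom W (GL (card S))"
    and "\<And>i. i < card S \<Longrightarrow> signed_rep W S m s f (s i) = signed_gen S m s f i"
  using theI'[OF signed_rep_ex1[OF assms]] unfolding signed_rep_def by blast+

end

theory Submission
  imports Defs
begin

text \<open>
  If the signs are balanced they are of the form \<open>\<epsilon> x * \<epsilon> y\<close>, so the representation is conjugate by a
  diagonal matrix to the geometric representation (all signs \<open>+1\<close>), which is faithful by Tits'
  argument: \<open>w\<close> maps the simple root of \<open>x\<close> to a nonnegative vector unless \<open>w x\<close> is shorter than \<open>w\<close>.

  Conversely, a shortest unbalanced closed walk is a chordless cycle \<open>v 0, \<dots>, v (k - 1)\<close>. Let \<open>\<beta>\<close> be
  the root obtained from the simple root of \<open>v 1\<close> by reflecting in \<open>v 2, \<dots>, v (k - 1)\<close>, and \<open>t\<close> its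
  reflection. The form pairs \<open>\<beta>\<close> with the simple root of \<open>v 0\<close> to \<open>\<plusminus> (1 + weight of the cycle)\<close>. This
  is \<open>0\<close>, so \<open>t\<close> and \<open>v 0\<close> have commuting images; but with all signs \<open>+1\<close> it is \<open>-2\<close> and the images
  do not commute, so \<open>t\<close> and \<open>v 0\<close> do not commute in \<open>W\<close>.
\<close>

section \<open>The reflection action\<close>

definition basis :: "'a \<Rightarrow> 'a \<Rightarrow> int" where
  "basis x = (\<lambda>z. if z = x then 1 else 0)"

lemma basis_self [simp]: "basis x x = 1"
  and basis_other [simp]: "z \<noteq> x \<Longrightarrow> basis x z = 0"
  by (simp_all add: basis_def)

text \<open>The sign matrix is a parameter because the locale is used with two matrices over the
  same \<open>S\<close> and \<open>m\<close>: the signed adjacency matrix and its entrywise absolute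
  value. The congruence on words depends only on \<open>S\<close> and \<open>m\<close>, so an
  equation in the group constrains both actions.\<close>

locale simply_laced_signing =
  fixes S :: "'a set" and m :: "'a \<Rightarrow> 'a \<Rightarrow> enat" and A :: "'a \<Rightarrow> 'a \<Rightarrow> int"
  assumes finite_S: "finite S"
    and A_sym: "A x y = A y x"
    and A_diag [simp]: "A x x = 0"
    and A_support: "A x y \<noteq> 0 \<Longrightarrow> x \<in> S"
    and A_order: "x \<in> S \<Longrightarrow> y \<in> S \<Longrightarrow> x \<noteq> y \<Longrightarrow>
      m x y = 2 \<and> A x y = 0 \<or> m x y = 3 \<and> (A x y = 1 \<or> A x y = -1)"
begin

lemma A_cases: "A x y = 0 \<or> A x y = 1 \<or> A x y = -1"
  by (metis A_diag A_order A_support A_sym)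

lemma A_square: "A x y \<noteq> 0 \<Longrightarrow> A x y * A x y = 1"
  using A_cases[of x y] by auto

text \<open>The row of \<open>x\<close> in the symmetric matrix \<open>2 I - A\<close>, applied to
  \<open>v\<close>; for nonnegative \<open>A\<close> this matrix is the simply laced Cartan matrix,
  and simple roots have norm 2.\<close>

definition pairing :: "'a \<Rightarrow> ('a \<Rightarrow> int) \<Rightarrow> int" where
  "pairing x v = 2 * v x - (\<Sum>y\<in>S. A x y * v y)"

definition reflect :: "'a \<Rightarrow> ('a \<Rightarrow> int) \<Rightarrow> 'a \<Rightarrow> int" where
  "reflect x v = (\<lambda>z. v z - pairing x v * basis x z)"

lemma reflect_apply: "reflect x v z = v z - pairing x v * basis x z"
  by (simp add: reflect_def)

abbreviation act :: "'a list \<Rightarrow> ('a \<Rightarrow> int) \<Rightarrow> 'a \<Rightarrow> int" where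
  "act \<equiv> foldr reflect"

text \<open>Linearity is kept in the shape of the reflection formula. The case \<open>c = -1\<close>
  gives sums, and \<open>u = 0\<close> gives multiples.\<close>

lemma pairing_diff: "pairing x (\<lambda>z. u z - c * v z) = pairing x u - c * pairing x v"
  by (simp add: pairing_def algebra_simps sum_subtractf sum_distrib_left)

lemma pairing_basis: "x \<in> S \<Longrightarrow> pairing y (basis x) = 2 * basis x y - A y x"
  using finite_S by (simp add: pairing_def basis_def if_distrib cong: if_cong)

lemma pairing_reflect:
  "x \<in> S \<Longrightarrow> pairing y (reflect x v) = pairing y v - pairing x v * (2 * basis x y - A y x)"
  by (simp add: reflect_def pairing_diff pairing_basis)

lemma reflect_diff: "reflect x (\<lambda>z. u z - c * v z) = (\<lambda>z. reflect x u z - c * reflect x v z)"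
  by (simp add: reflect_def pairing_diff fun_eq_iff algebra_simps)

lemma act_diff: "act xs (\<lambda>z. u z - c * v z) = (\<lambda>z. act xs u z - c * act xs v z)"
  by (induction xs) (simp_all add: reflect_diff)

lemma reflect_reflect: "x \<in> S \<Longrightarrow> reflect x (reflect x v) = v"
  by (simp add: fun_eq_iff reflect_apply pairing_reflect)

lemma reflect_commute:
  assumes "x \<in> S" "y \<in> S" "x \<noteq> y" "A x y = 0"
  shows "reflect x (reflect y v) = reflect y (reflect x v)"
proof -
  have "A y x = 0" using assms A_sym[of x y] by simp
  then show ?thesis using assms by (simp add: fun_eq_iff reflect_apply pairing_reflect)
qed

lemma reflect_braid:
  assumes "x \<in> S" "y \<in> S" "x \<noteq> y" "A x y = 1 \<or> A x y = -1"
  shows "reflect x (reflect y (reflect x v)) = reflect y (reflect x (reflect y v))"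
  using assms(4)
proof
  assume "A x y = 1"
  moreover have "A y x = 1" using calculation A_sym[of x y] by simp
  ultimately show ?thesis
    using assms(1-3) by (simp add: fun_eq_iff reflect_apply pairing_reflect) (simp add: algebra_simps)
next
  assume "A x y = -1"
  moreover have "A y x = -1" using calculation A_sym[of x y] by simp
  ultimately show ?thesis
    using assms(1-3) by (simp add: fun_eq_iff reflect_apply pairing_reflect) (simp add: algebra_simps)
qed

lemma reflect_basis_self: "x \<in> S \<Longrightarrow> reflect x (basis x) = (\<lambda>z. - basis x z)"
  by (simp add: fun_eq_iff reflect_apply pairing_basis)

lemma reflect_basis: "x \<in> S \<Longrightarrow> x \<noteq> y \<Longrightarrow> reflect y (basis x) = (\<lambda>z. basis x z + A x y * basis y z)"
  by (simp add: fun_eq_iff reflect_apply pairing_basis A_sym[of y x])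

section \<open>The invariant bilinear form\<close>

definition form :: "('a \<Rightarrow> int) \<Rightarrow> ('a \<Rightarrow> int) \<Rightarrow> int" where
  "form u v = (\<Sum>x\<in>S. u x * pairing x v)"

lemma form_commute: "form u v = form v u"
proof -
  have "(\<Sum>x\<in>S. \<Sum>y\<in>S. u x * (A x y * v y)) = (\<Sum>x\<in>S. \<Sum>y\<in>S. v x * (A x y * u y))"
    by (subst sum.swap) (simp add: A_sym mult_ac)
  then show ?thesis
    by (simp add: form_def pairing_def algebra_simps sum_subtractf sum_distrib_left)
qed

lemma form_basis: "x \<in> S \<Longrightarrow> form (basis x) v = pairing x v"
  using finite_S by (simp add: form_def basis_def if_distrib[of "\<lambda>a. a * _"] cong: if_cong)

lemma form_diff: "form (\<lambda>z. u z - c * w z) v = form u v - c * form w v"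
  by (simp add: form_def algebra_simps sum_subtractf sum_distrib_left)

lemma form_reflect: "x \<in> S \<Longrightarrow> form (reflect x u) v = form u (reflect x v)"
  by (subst (2) form_commute) (simp add: reflect_def form_diff form_basis form_commute[of v u])

lemma form_act: "set xs \<subseteq> S \<Longrightarrow> form (act xs u) v = form u (act (rev xs) v)"
  by (induction xs arbitrary: u v) (simp_all add: form_reflect)

lemma act_rev: "set xs \<subseteq> S \<Longrightarrow> act xs (act (rev xs) v) = v"
  by (induction xs arbitrary: v) (simp_all add: reflect_reflect)

text \<open>Since \<open>pairing x\<close> is \<open>form (basis x)\<close>, adjointness moves
  \<open>act (rev xs)\<close> to the other argument as \<open>act xs\<close>. So a conjugate of a
  simple reflection is the reflection in the image of the simple root.\<close>

lemma act_conjugate: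
  assumes "set xs \<subseteq> S" "x \<in> S"
  shows "act (xs @ [x] @ rev xs) v =
    (\<lambda>z. v z - form (act xs (basis x)) v * act xs (basis x) z)"
proof -
  have "act (xs @ [x] @ rev xs) v =
      (\<lambda>z. v z - pairing x (act (rev xs) v) * act xs (basis x) z)"
    using assms by (simp add: reflect_def[of x] act_diff act_rev)
  then show ?thesis using assms by (simp add: form_act form_basis)
qed


section \<open>Words in the generators\<close>

abbreviation pos :: "'a list \<Rightarrow> 'a gword" where
  "pos \<equiv> map (\<lambda>x. (x, True))"

abbreviation weq :: "'a gword \<Rightarrow> 'a gword \<Rightarrow> bool" where
  "weq \<equiv> word_equiv S (coxeter_relators S m)"

lemma pos_gwords [simp]: "pos xs \<in> gwords S \<longleftrightarrow> set xs \<subseteq> S"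
  by (auto simp: gwords_def)

lemma relators_gwords: "coxeter_relators S m \<subseteq> gwords S"
  by (auto simp: coxeter_relators_def gwords_def split: if_splits)

lemma weq_gwords: "weq u v \<Longrightarrow> u \<in> gwords S \<and> v \<in> gwords S"
  by (induction rule: word_equiv.induct) (use relators_gwords in auto)

lemma weq_context:
  "weq u v \<Longrightarrow> p \<in> gwords S \<Longrightarrow> q \<in> gwords S \<Longrightarrow> weq (p @ u @ q) (p @ v @ q)"
proof (induction rule: word_equiv.induct)
  case (cancel u v x b)
  then show ?case using word_equiv.cancel[of "p @ u" S "v @ q" x _ b] by simp
next
  case (relator u v r)
  then show ?case using word_equiv.relator[of "p @ u" S "v @ q" r] by simp
qed (auto intro: word_equiv.intros)

lemma weq_pos_context:
  "weq (pos u) (pos v) \<Longrightarrow> set p \<subseteq> S \<Longrightarrow> set q \<subseteq> S \<Longrightarrow> weq (pos (p @ u @ q)) (pos (p @ v @ q))"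
  using weq_context[of "pos u" "pos v" "pos p" "pos q"] by simp

lemma weq_square: "x \<in> S \<Longrightarrow> weq (pos [x, x]) (pos [])"
  using word_equiv.relator[of "[]" S "[]" "pos [x, x]" "coxeter_relators S m"]
  by (auto simp: coxeter_relators_def)

lemma weq_pos_all:
  assumes "u \<in> gwords S" shows "weq u (pos (map fst u))"
  using assms
proof (induction u)
  case (Cons a u)
  obtain x b where a: "a = (x, b)" by (cases a)
  have x: "x \<in> S" and u: "u \<in> gwords S" using Cons.prems a by auto
  have "weq [(x, False)] ([(x, False)] @ pos [x, x])"
    using word_equiv.sym[OF weq_context[OF weq_square[OF x], of "[(x, False)]" "[]"]] x by simp
  moreover have "weq ([(x, False)] @ pos [x, x]) (pos [x])"
    using word_equiv.cancel[of "[]" S "pos [x]" x _ False] x by simp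
  ultimately have "weq [(x, b)] (pos [x])"
    using x by (cases b) (auto intro: word_equiv.intros)
  from weq_context[OF this, of "[]" u] have "weq (a # u) ((x, True) # u)" using a u by simp
  moreover have "weq ((x, True) # u) ((x, True) # pos (map fst u))"
    using weq_context[OF Cons.IH[OF u], of "[(x, True)]" "[]"] x by simp
  ultimately show ?case using a by (auto intro: word_equiv.trans)
qed (auto intro: word_equiv.refl)

text \<open>For involutive generators \<open>rev ys\<close> is inverse to \<open>ys\<close>, so
  appending \<open>ys\<close> turns a relator into an equation. This is how the relators of length 4
  and 6 become commutation and braid relations.\<close>

lemma weq_by_relator:
  assumes xs: "set xs \<subseteq> S" and ys: "set ys \<subseteq> S" and r: "weq (pos (xs @ rev ys)) (pos [])"
  shows "weq (pos xs) (pos ys)"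
proof -
  have rev: "weq (pos (rev zs @ zs)) (pos [])" if "set zs \<subseteq> S" for zs
    using that
  proof (induction zs)
    case (Cons z zs)
    then have "weq (pos (rev zs @ [z, z] @ zs)) (pos (rev zs @ [] @ zs))"
      by (intro weq_pos_context weq_square) auto
    with Cons show ?case by (auto intro: word_equiv.trans)
  qed (auto intro: word_equiv.refl)
  have "weq (pos (xs @ rev ys @ ys)) (pos (xs @ []))"
    using weq_pos_context[OF rev[OF ys], of xs "[]"] xs by simp
  moreover have "weq (pos (xs @ rev ys @ ys)) (pos ys)"
    using weq_pos_context[OF r, of "[]" ys] ys by simp
  ultimately show ?thesis by (metis append_Nil2 word_equiv.sym word_equiv.trans)
qed

lemma weq_commute:
  assumes "x \<in> S" "y \<in> S" "x \<noteq> y" "A x y = 0"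
  shows "weq (pos [x, y]) (pos [y, x])"
proof (rule weq_by_relator)
  have "m x y = enat 2" using A_order[OF assms(1-3)] assms(4) by (simp add: numeral_eq_enat)
  then have "concat (replicate 2 [(x, True), (y, True)]) \<in> coxeter_relators S m"
    unfolding coxeter_relators_def using assms by blast
  from word_equiv.relator[OF _ _ this, of "[]" S "[]"]
  show "weq (pos ([x, y] @ rev [y, x])) (pos [])" by (simp add: numeral_eq_Suc)
qed (use assms in auto)

lemma weq_braid:
  assumes "x \<in> S" "y \<in> S" "x \<noteq> y" "A x y \<noteq> 0"
  shows "weq (pos [x, y, x]) (pos [y, x, y])"
proof (rule weq_by_relator)
  have "m x y = enat 3" using A_order[OF assms(1-3)] assms(4) by (simp add: numeral_eq_enat)
  then have "concat (replicate 3 [(x, True), (y, True)]) \<in> coxeter_relators S m"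
    unfolding coxeter_relators_def using assms by blast
  from word_equiv.relator[OF _ _ this, of "[]" S "[]"]
  show "weq (pos ([x, y, x] @ rev [y, x, y])) (pos [])" by (simp add: numeral_eq_Suc)
qed (use assms in auto)

section \<open>The action of the presented group\<close>

lemma act_relator:
  assumes "r \<in> coxeter_relators S m" shows "act (map fst r) v = v"
  using assms unfolding coxeter_relators_def
proof (elim UnE CollectE exE conjE)
  fix x y k
  assume r: "r = concat (replicate k [(x, True), (y, True)])"
    and xy: "x \<in> S" "y \<in> S" "x \<noteq> y" and k: "m x y = enat k"
  from A_order[OF xy] show ?thesis
  proof
    assume A: "m x y = 2 \<and> A x y = 0"
    then have "k = 2" using k by (simp add: numeral_eq_enat)
    then show ?thesis using r reflect_commute[of x y] A xy
      by (simp add: numeral_eq_Suc reflect_reflect)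
  next
    assume A: "m x y = 3 \<and> (A x y = 1 \<or> A x y = -1)"
    then have "k = 3" using k by (simp add: numeral_eq_enat)
    then show ?thesis using r reflect_braid[of x y] A xy
      by (simp add: numeral_eq_Suc reflect_reflect)
  qed
qed (simp add: reflect_reflect)

text \<open>\<open>map fst\<close> forgets inverses, so a cancelling pair becomes a square and acts
  trivially, as do the relators. Hence \<open>act\<close> depends only on the group element.\<close>

lemma weq_act: "weq u v \<Longrightarrow> act (map fst u) = act (map fst v)"
  by (induction rule: word_equiv.induct) (auto simp: fun_eq_iff reflect_reflect act_relator)

lemma weq_pos_act: "weq (pos xs) (pos ys) \<Longrightarrow> act xs = act ys"
  using weq_act[of "pos xs" "pos ys"] by (simp add: comp_def)


section \<open>Positivity of roots\<close>

text \<open>The Coxeter length of the group element of \<open>xs\<close>; \<open>weq\<close> itself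
  forces \<open>ys\<close> to be a word over \<open>S\<close>.\<close>

definition len :: "'a list \<Rightarrow> nat" where
  "len xs = (LEAST k. \<exists>ys. weq (pos xs) (pos ys) \<and> length ys = k)"

lemma len_le: "weq (pos xs) (pos ys) \<Longrightarrow> len xs \<le> length ys"
  unfolding len_def by (rule Least_le) auto

lemma len_reduced:
  assumes "set xs \<subseteq> S"
  obtains ys where "weq (pos xs) (pos ys)" "length ys = len xs" "set ys \<subseteq> S"
proof -
  have "\<exists>ys. weq (pos xs) (pos ys) \<and> length ys = len xs"
    unfolding len_def by (rule LeastI[of _ "length xs"]) (use assms in \<open>auto intro!: exI[of _ xs] word_equiv.refl\<close>)
  then show ?thesis using that weq_gwords by (metis pos_gwords)
qed

lemma len_weq:
  assumes "weq (pos xs) (pos ys)" shows "len xs = len ys"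
proof -
  have "weq (pos xs) zs \<longleftrightarrow> weq (pos ys) zs" for zs
    using word_equiv.trans[OF assms] word_equiv.trans[OF word_equiv.sym[OF assms]] by blast
  then show ?thesis by (simp add: len_def)
qed

lemma len_append:
  assumes "set xs \<subseteq> S" "set ys \<subseteq> S"
  shows "len (xs @ ys) \<le> len xs + length ys"
proof -
  obtain zs where "weq (pos xs) (pos zs)" "length zs = len xs" by (rule len_reduced[OF assms(1)])
  then show ?thesis using len_le[of "xs @ ys" "zs @ ys"] weq_pos_context[of xs zs "[]" ys] assms by simp
qed

text \<open>Take for \<open>y\<close> the last letter of a reduced word: multiplying by it cancels
  that letter.\<close>

lemma len_descent:
  assumes "set xs \<subseteq> S" "len xs > 0"
  obtains y where "y \<in> S" "len (xs @ [y]) < len xs"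
proof -
  obtain zs where zs: "weq (pos xs) (pos zs)" "length zs = len xs" "set zs \<subseteq> S"
    by (rule len_reduced[OF assms(1)])
  then obtain ws y where ws: "zs = ws @ [y]" using assms(2) by (cases zs rule: rev_cases) auto
  then have S: "set ws \<subseteq> S" "y \<in> S" using zs by auto
  have "weq (pos (xs @ [y])) (pos (ws @ [y, y]))"
    using weq_pos_context[OF zs(1), of "[]" "[y]"] S ws by simp
  moreover have "weq (pos (ws @ [y, y])) (pos ws)"
    using weq_pos_context[OF weq_square, of y ws "[]"] S by simp
  ultimately have "len (xs @ [y]) \<le> length ws" by (blast intro: len_le word_equiv.trans)
  then show ?thesis using that S ws zs by auto
qed

text \<open>Tits' argument, by induction on the length of \<open>w\<close>. Choose a right descent
  \<open>y\<close> of \<open>w\<close>. As \<open>x\<close> and \<open>y\<close> generate a group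
  with relation of order 2 or 3, it is enough to pass to the shorter elements \<open>w y\<close> or
  \<open>w y x\<close> and to write the image of the root of \<open>x\<close> as a nonnegative
  combination of images under these.\<close>

lemma act_basis_nonneg:
  assumes nonneg: "\<And>x y. 0 \<le> A x y"
  shows "set w \<subseteq> S \<Longrightarrow> x \<in> S \<Longrightarrow> len w \<le> len (w @ [x]) \<Longrightarrow> 0 \<le> act w (basis x) z"
proof (induction "len w" arbitrary: w x rule: less_induct)
  case less
  show ?case
  proof (cases "len w = 0")
    case True
    then have "weq (pos w) (pos [])" using len_reduced[OF less(2)] by auto
    then show ?thesis using weq_pos_act[of w "[]"] by (simp add: basis_def)
  next
    case False
    then obtain y where y: "y \<in> S" "len (w @ [y]) < len w" using len_descent[OF less(2)] by auto
    then have xy: "x \<noteq> y" using less(4) by auto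
    have ws: "weq (pos (w @ [y, y])) (pos w)"
      using weq_pos_context[OF weq_square, of y w "[]"] less(2) y by simp
    have act_w: "act w v = act (w @ [y]) (reflect y v)" for v
      using weq_pos_act[OF ws] by (simp add: fun_eq_iff)
    show ?thesis
    proof (cases "A x y = 0")
      case True
      have yx: "weq (pos (w @ [y, x])) (pos (w @ [x, y]))"
        using weq_pos_context[OF weq_commute, of x y w "[]"] True xy less(2,3) y
        by (auto intro: word_equiv.sym)
      have xyy: "weq (pos (w @ [x, y, y])) (pos (w @ [x]))"
        using weq_pos_context[OF weq_square, of y "w @ [x]" "[]"] less(2,3) y by simp
      \<comment> \<open>Here \<open>w y x = w x y\<close>, which differs from \<open>w x\<close> by
        one letter. As \<open>w y\<close> is shorter than \<open>w\<close> and \<open>w x\<close> is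
        not, \<open>w y x\<close> cannot be shorter than \<open>w y\<close>.\<close>
      have "len (w @ [x]) \<le> len (w @ [y, x]) + 1"
        using len_append[of "w @ [x, y]" "[y]"] len_weq[OF yx] len_weq[OF xyy] less(2,3) y by simp
      then have "len (w @ [y]) \<le> len ((w @ [y]) @ [x])" using y less(4) by simp
      then have "0 \<le> act (w @ [y]) (basis x) z"
        using less(1)[of "w @ [y]" x] less(2,3) y by simp
      moreover have "reflect y (basis x) = basis x" using True xy less(3) by (simp add: reflect_basis)
      ultimately show ?thesis by (simp only: act_w[of "basis x"])
    next
      case False
      have A: "A x y = 1" using A_cases[of x y] nonneg[of x y] False by auto
      then have y_x: "reflect y (basis x) = (\<lambda>z. basis x z - (-1) * basis y z)"
        using xy less(3) by (simp add: reflect_basis)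
      show ?thesis
      \<comment> \<open>Reflecting in \<open>y\<close> gives the sum of the two simple roots. If
        \<open>w y x\<close> is not shorter than \<open>w y\<close>, both summands have nonnegative
        images under \<open>w y\<close>; otherwise \<open>x\<close> is split off as well.\<close>
      proof (cases "len (w @ [y]) \<le> len (w @ [y, x])")
        case True
        have "0 \<le> act (w @ [y]) (basis x) z"
          using less(1)[of "w @ [y]" x] less(2,3) y True by simp
        moreover have "len ((w @ [y]) @ [y]) = len w" using len_weq[OF ws] by simp
        then have "0 \<le> act (w @ [y]) (basis y) z"
          using less(1)[of "w @ [y]" y] less(2,3) y by simp
        moreover have "act w (basis x) z = act (w @ [y]) (basis x) z - (-1) * act (w @ [y]) (basis y) z"
          by (simp only: act_w[of "basis x"] y_x act_diff)
        ultimately show ?thesis by linarith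
      next
        case False
        let ?u = "w @ [y, x]"
        have "weq (pos (w @ [y, x, x])) (pos (w @ [y]))"
          using weq_pos_context[OF weq_square, of x "w @ [y]" "[]"] less(2,3) y by simp
        then have wux: "act (w @ [y]) v = act ?u (reflect x v)" for v
          using weq_pos_act[of "w @ [y, x, x]" "w @ [y]"] by (simp add: fun_eq_iff)
        have yxy: "weq (pos (w @ [y, x, y])) (pos (w @ [x, y, x]))"
          using weq_pos_context[OF weq_braid, of x y w "[]"] A xy less(2,3) y
          by (auto intro: word_equiv.sym)
        have xyxxy: "weq (pos (w @ [x, y, x, x, y])) (pos (w @ [x]))"
        proof -
          have "weq (pos (w @ [x, y, x, x, y])) (pos (w @ [x, y, y]))"
            using weq_pos_context[OF weq_square, of x "w @ [x, y]" "[y]"] less(2,3) y by simp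
          moreover have "weq (pos (w @ [x, y, y])) (pos (w @ [x]))"
            using weq_pos_context[OF weq_square, of y "w @ [x]" "[]"] less(2,3) y by simp
          ultimately show ?thesis by (rule word_equiv.trans)
        qed
        \<comment> \<open>By the braid relation \<open>w x = (w y x y) x y\<close>. Two descents put
          \<open>?u\<close> at least 2 below \<open>w\<close>, hence at least 2 below
          \<open>w x\<close>, so appending \<open>y\<close> to \<open>?u\<close> cannot shorten
          it.\<close>
        have "len (w @ [x]) \<le> len (?u @ [y]) + 2"
          using len_append[of "w @ [x, y, x]" "[x, y]"] len_weq[OF yxy] len_weq[OF xyxxy] less(2,3) y
          by simp
        then have "len ?u \<le> len (?u @ [y])" using y less(4) False by simp
        then have "0 \<le> act ?u (basis y) z"
          using less(1)[of ?u y] less(2,3) y False by simp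
        moreover have "reflect x (reflect y (basis x)) = basis y"
          unfolding y_x reflect_diff
          using A xy less(2,3) y by (simp add: reflect_basis reflect_basis_self A_sym[of y x])
        then have "act w (basis x) = act ?u (basis y)" by (simp only: act_w[of "basis x"] wux)
        ultimately show ?thesis by simp
      qed
    qed
  qed
qed

text \<open>A nontrivial \<open>w\<close> has a right descent \<open>x\<close>. Then
  \<open>w x\<close> sends the simple root of \<open>x\<close> to a nonnegative vector, so
  \<open>w\<close> sends it to a nonpositive one, against the coordinate 1. Only diagonal entries
  are tested, since conjugation by a diagonal matrix preserves them.\<close>

theorem act_faithful:
  assumes nonneg: "\<And>x y. 0 \<le> A x y" and w: "set w \<subseteq> S"
    and fixes_basis: "\<And>x. x \<in> S \<Longrightarrow> act w (basis x) x = 1"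
  shows "weq (pos w) (pos [])"
proof (cases "len w = 0")
  case True
  then show ?thesis using len_reduced[OF w] by auto
next
  case False
  then obtain x where x: "x \<in> S" "len (w @ [x]) < len w" using len_descent[OF w] by auto
  have ws: "weq (pos (w @ [x, x])) (pos w)"
    using weq_pos_context[OF weq_square, of x w "[]"] w x by simp
  then have "len (w @ [x]) \<le> len ((w @ [x]) @ [x])" using x len_weq[OF ws] by simp
  then have "0 \<le> act (w @ [x]) (basis x) x" using w x by (intro act_basis_nonneg nonneg) auto
  also have "act (w @ [x]) (basis x) x = - act w (basis x) x"
    using act_diff[of w "\<lambda>z. 0" 1 "basis x"] act_diff[of w "\<lambda>z. 0" 1 "\<lambda>z. 0"] x
    by (simp add: reflect_basis_self fun_eq_iff)
  finally show ?thesis using fixes_basis[OF x(1)] by simp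
qed


section \<open>Signed walks\<close>

text \<open>Length and weight are indices, so that concatenation adds the one and multiplies the
  other, and a shortest closed walk of weight -1 can be chosen. The empty walk exists at every point
  of the type, also outside \<open>S\<close>.\<close>

inductive walk :: "'a \<Rightarrow> 'a \<Rightarrow> nat \<Rightarrow> int \<Rightarrow> bool" where
  Nil: "walk x x 0 1"
| snoc: "walk x y k \<sigma> \<Longrightarrow> A y z \<noteq> 0 \<Longrightarrow> walk x z (Suc k) (\<sigma> * A y z)"

lemma walk_sign: "walk x y k \<sigma> \<Longrightarrow> \<sigma> = 1 \<or> \<sigma> = -1"
proof (induction rule: walk.induct)
  case (snoc x y k \<sigma> z)
  then show ?case using A_cases[of y z] by auto
qed simp

lemma walk_edge: "A x y \<noteq> 0 \<Longrightarrow> walk x y 1 (A x y)"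
  using walk.snoc[OF walk.Nil, of x y] by simp

lemma walk_append: "walk y z l \<tau> \<Longrightarrow> walk x y k \<sigma> \<Longrightarrow> walk x z (k + l) (\<sigma> * \<tau>)"
proof (induction rule: walk.induct)
  case (snoc y z l \<tau> u)
  then show ?case using walk.snoc[OF snoc.IH[OF snoc.prems] snoc.hyps(2)] by (simp add: mult_ac)
qed simp

lemma walk_rev: "walk x y k \<sigma> \<Longrightarrow> walk y x k \<sigma>"
proof (induction rule: walk.induct)
  case (snoc x y k \<sigma> z)
  then have "walk z y 1 (A y z)" using walk_edge[of z y] A_sym[of z y] by simp
  from walk_append[OF snoc.IH this] show ?case by (simp add: mult_ac)
qed (rule walk.Nil)

lemma walk_vertices:
  "walk x y k \<sigma> \<Longrightarrow> \<exists>v. v 0 = x \<and> v k = y \<and> (\<Prod>i<k. A (v i) (v (Suc i))) = \<sigma>"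
proof (induction rule: walk.induct)
  case (snoc x y k \<sigma> z)
  then obtain v where "v 0 = x" "v k = y" "(\<Prod>i<k. A (v i) (v (Suc i))) = \<sigma>" by auto
  then show ?case by (intro exI[of _ "v(Suc k := z)"]) auto
qed auto

lemma walk_segment:
  assumes "i \<le> j" "\<And>l. i \<le> l \<Longrightarrow> l < j \<Longrightarrow> A (v l) (v (Suc l)) \<noteq> 0"
  shows "walk (v i) (v j) (j - i) (\<Prod>l=i..<j. A (v l) (v (Suc l)))"
  using assms
proof (induction rule: dec_induct)
  case base
  then show ?case using walk.Nil by simp
next
  case (step j)
  then show ?case using walk.snoc[of "v i" "v j" "j - i" _ "v (Suc j)"] by (simp add: Suc_diff_le)
qed

text \<open>Choose a base point in each connected component and let \<open>\<epsilon> x\<close> be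
  the weight of some walk from it to \<open>x\<close>. Going out to \<open>x\<close>, across an edge
  and back from \<open>y\<close> is a closed walk, so balance determines the sign of the
  edge.\<close>

lemma potential:
  assumes bal: "\<And>x k \<sigma>. walk x x k \<sigma> \<Longrightarrow> \<sigma> = 1"
  obtains \<epsilon> :: "'a \<Rightarrow> int" where "\<And>x. \<epsilon> x * \<epsilon> x = 1" "\<And>x y. A x y = \<epsilon> x * \<epsilon> y * \<bar>A x y\<bar>"
proof -
  define base where "base x = (SOME y. \<exists>k \<sigma>. walk y x k \<sigma>)" for x
  define \<epsilon> where "\<epsilon> x = (SOME \<sigma>. \<exists>k. walk (base x) x k \<sigma>)" for x
  have base: "\<exists>k \<sigma>. walk (base x) x k \<sigma>" for x
    unfolding base_def by (rule someI_ex) (blast intro: walk.Nil)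
  have \<epsilon>: "\<exists>k. walk (base x) x k (\<epsilon> x)" for x
    unfolding \<epsilon>_def by (rule someI_ex) (use base in blast)
  have sq: "\<epsilon> x * \<epsilon> x = 1" for x using \<epsilon>[of x] walk_sign by fastforce
  have "A x y = \<epsilon> x * \<epsilon> y * \<bar>A x y\<bar>" for x y
  proof (cases "A x y = 0")
    case False
    have e: "walk x y 1 (A x y)" using walk_edge[OF False] .
    \<comment> \<open>Adjacent vertices are reachable from the same points, so \<open>SOME\<close>
      is applied to equal predicates and picks the same base point.\<close>
    have "(\<exists>k \<sigma>. walk z x k \<sigma>) \<longleftrightarrow> (\<exists>k \<sigma>. walk z y k \<sigma>)" for z
      using walk_append[OF e] walk_append[OF walk_rev[OF e]] by blast
    then have "base x = base y" by (simp add: base_def)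
    then obtain k l where "walk (base x) x k (\<epsilon> x)" "walk y (base x) l (\<epsilon> y)"
      using \<epsilon>[of x] \<epsilon>[of y] walk_rev by metis
    from bal[OF walk_append[OF this(2) walk_append[OF e this(1)]]]
    have "\<epsilon> x * A x y * \<epsilon> y = 1" .
    moreover have "\<epsilon> x = 1 \<or> \<epsilon> x = -1" "\<epsilon> y = 1 \<or> \<epsilon> y = -1" using \<epsilon> walk_sign by blast+
    ultimately show ?thesis using A_cases[of x y] by auto
  qed simp
  with sq show ?thesis using that by blast
qed

end

text \<open>The vertices are \<open>v 0, \<dots>, v (k - 1)\<close>, and \<open>v k\<close> repeats \<open>v 0\<close>.\<close>

definition chordless_cycle :: "('a \<Rightarrow> 'a \<Rightarrow> int) \<Rightarrow> (nat \<Rightarrow> 'a) \<Rightarrow> nat \<Rightarrow> bool" where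
  "chordless_cycle A v k \<longleftrightarrow> 3 \<le> k \<and> v k = v 0 \<and> inj_on v {..<k} \<and>
     (\<forall>i<k. A (v i) (v (Suc i)) \<noteq> 0) \<and>
     (\<forall>i j. i < j \<longrightarrow> j < k \<longrightarrow> A (v i) (v j) \<noteq> 0 \<longrightarrow> j = Suc i \<or> i = 0 \<and> Suc j = k)"

lemma chordless_cycle_neq: "chordless_cycle A v k \<Longrightarrow> i < j \<Longrightarrow> j < k \<Longrightarrow> v i \<noteq> v j"
  using inj_on_eq_iff[of v "{..<k}" i j] by (simp add: chordless_cycle_def)

lemma chordless_cycle_nonadjacent:
  "chordless_cycle A v k \<Longrightarrow> i < j \<Longrightarrow> j < k \<Longrightarrow> j \<noteq> Suc i \<Longrightarrow> i \<noteq> 0 \<or> Suc j \<noteq> k \<Longrightarrow>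
    A (v i) (v j) = 0"
  unfolding chordless_cycle_def by blast

text \<open>\<open>foldr\<close> applies the last letter first: acting by this word reflects in
  \<open>v 2\<close>, then \<open>v 3\<close>, and so on up to \<open>v j\<close>. For
  \<open>j = 1\<close> the word is empty.\<close>

definition cycle_word :: "(nat \<Rightarrow> 'a) \<Rightarrow> nat \<Rightarrow> 'a list" where
  "cycle_word v j = rev (map v [2..<Suc j])"

text \<open>A word for the reflection in the root obtained from that of \<open>v 1\<close> by going
  once around the cycle, stopping before \<open>v 0\<close>.\<close>

definition cycle_reflection :: "(nat \<Rightarrow> 'a) \<Rightarrow> nat \<Rightarrow> 'a list" where
  "cycle_reflection v k = cycle_word v (k - 1) @ [v 1] @ rev (cycle_word v (k - 1))"

section \<open>Shortest unbalanced closed walks\<close>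

context simply_laced_signing
begin

text \<open>In a shortest closed walk of weight -1, a repeated vertex or a chord would cut off two
  shorter closed walks whose weights multiply to -1, and one of them would again have weight
  -1.\<close>

lemma unbalanced_chordless_cycle:
  assumes "walk x x l (-1)"
  obtains v k where "chordless_cycle A v k" "(\<Prod>i<k. A (v i) (v (Suc i))) = -1"
proof -
  define k where "k = (LEAST k. \<exists>x. walk x x k (-1))"
  have "\<exists>x. walk x x k (-1)" unfolding k_def by (rule LeastI[of _ l]) (use assms in blast)
  then obtain y where y: "walk y y k (-1)" by blast
  have least: "k \<le> l" if "walk x x l (-1)" for x l
    unfolding k_def by (rule Least_le) (use that in blast)
  from walk_vertices[OF y] obtain v where v0: "v 0 = y" and vk: "v k = y"
    and w: "(\<Prod>i<k. A (v i) (v (Suc i))) = -1" by blast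
  have nz: "A (v i) (v (Suc i)) \<noteq> 0" if "i < k" for i
  proof
    assume "A (v i) (v (Suc i)) = 0"
    then have "(\<Prod>i<k. A (v i) (v (Suc i))) = 0" using that by (intro prod_zero) auto
    then show False using w by simp
  qed
  define P where "P i j = (\<Prod>l=i..<j. A (v l) (v (Suc l)))" for i j
  have seg: "walk (v i) (v j) (j - i) (P i j)" if "i \<le> j" "j \<le> k" for i j
    unfolding P_def by (rule walk_segment[where v = v]) (use that nz in simp_all)
  have split: "P 0 i * P i j * P j k = -1" if "i \<le> j" "j \<le> k" for i j
    using w that by (simp add: P_def prod.atLeastLessThan_concat lessThan_atLeast0)
  have shorter: "k \<le> l \<or> k \<le> l'"
    if "walk x x l \<sigma>" "walk x' x' l' \<sigma>'" "\<sigma> * \<sigma>' = -1" for x l \<sigma> x' l' \<sigma>'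
  proof -
    have "\<sigma> = -1 \<or> \<sigma>' = -1" using walk_sign[OF that(1)] walk_sign[OF that(2)] that(3) by auto
    then show ?thesis using least[of x l] least[of x' l'] that(1,2) by metis
  qed
  have inj: "v i \<noteq> v j" if "i < j" "j < k" for i j
  proof
    assume eq: "v i = v j"
    have "walk (v i) (v i) (j - i) (P i j)" using seg[of i j] that eq by simp
    moreover have "walk y y (i + (k - j)) (P 0 i * P j k)"
      using walk_append[of "v i" y "k - j" "P j k" y i "P 0 i"] seg[of 0 i] seg[of j k] that eq v0 vk by simp
    moreover have "P i j * (P 0 i * P j k) = -1" using split[of i j] that by (simp add: mult_ac)
    ultimately have "k \<le> j - i \<or> k \<le> i + (k - j)" by (rule shorter)
    then show False using that by auto
  qed
  \<comment> \<open>Both closed walks use the chord once, so it contributes a square, which is 1.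
    Their lengths \<open>j - i + 1\<close> and \<open>i + 1 + (k - j)\<close> are below
    \<open>k\<close> except when \<open>v i\<close> and \<open>v j\<close> are consecutive on the
    cycle.\<close>
  have chord: "j = Suc i \<or> i = 0 \<and> Suc j = k" if "i < j" "j < k" "A (v i) (v j) \<noteq> 0" for i j
  proof -
    have e: "walk (v i) (v j) 1 (A (v i) (v j))" using walk_edge[OF that(3)] .
    have "walk (v i) (v i) (j - i + 1) (P i j * A (v i) (v j))"
      using walk_append[OF walk_rev[OF e] seg[of i j]] that by simp
    moreover have "walk y y (i + 1 + (k - j)) (P 0 i * A (v i) (v j) * P j k)"
      using walk_append[OF seg[of j k] walk_append[OF e seg[of 0 i]]] that v0 vk by simp
    moreover have "P i j * A (v i) (v j) * (P 0 i * A (v i) (v j) * P j k) =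
        (P 0 i * P i j * P j k) * (A (v i) (v j) * A (v i) (v j))" by (simp add: mult_ac)
    then have "P i j * A (v i) (v j) * (P 0 i * A (v i) (v j) * P j k) = -1"
      using split[of i j] A_square[OF that(3)] that by simp
    ultimately have "k \<le> j - i + 1 \<or> k \<le> i + 1 + (k - j)" by (rule shorter)
    then show ?thesis using that by auto
  qed
  \<comment> \<open>Length 0 has weight 1, length 1 would be a loop with entry 0, and length 2 runs
    along one edge twice, so its weight is a square.\<close>
  have "3 \<le> k"
  proof (rule ccontr)
    assume "\<not> 3 \<le> k"
    then have "k = 0 \<or> k = 1 \<or> k = 2" by auto
    moreover have "A y (v (Suc 0)) * A (v (Suc 0)) y \<noteq> -1"
      using A_sym[of "v (Suc 0)" y] A_cases[of y "v (Suc 0)"] by auto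
    ultimately show False using w v0 vk by (auto simp: numeral_2_eq_2)
  qed
  moreover have "inj_on v {..<k}" by (rule linorder_inj_onI) (use inj in auto)
  ultimately have "chordless_cycle A v k"
    unfolding chordless_cycle_def using v0 vk nz chord by (intro conjI allI impI) simp_all
  then show ?thesis using w that by blast
qed


section \<open>Chordless cycles and commuting reflections\<close>

lemma chordless_cycle_in_S: "chordless_cycle A v k \<Longrightarrow> i < k \<Longrightarrow> v i \<in> S"
  using A_support unfolding chordless_cycle_def by blast

lemma pairing_combination:
  assumes "finite I" "v ` I \<subseteq> S"
  shows "pairing x (\<lambda>z. \<Sum>i\<in>I. c i * basis (v i) z) = (\<Sum>i\<in>I. c i * pairing x (basis (v i)))"
  using assms
proof (induction I)
  case (insert i I)
  then show ?case
    using pairing_diff[of x "\<lambda>z. \<Sum>i\<in>I. c i * basis (v i) z" "- c i" "basis (v i)"]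
    by (simp add: algebra_simps)
qed (simp add: pairing_def)

text \<open>Without chords, \<open>v (Suc j)\<close> is adjacent to \<open>v j\<close> alone among
  \<open>v 1, ..., v j\<close>. So each reflection adds one new simple root, with the previous
  coefficient times the sign of the new edge.\<close>

lemma cycle_root:
  assumes c: "chordless_cycle A v k" and j: "1 \<le> j" "j < k"
  shows "act (cycle_word v j) (basis (v 1)) =
    (\<lambda>z. \<Sum>i=1..j. (\<Prod>l=1..<i. A (v l) (v (Suc l))) * basis (v i) z)"
  using j
proof (induction rule: dec_induct)
  case base
  then show ?case by (simp add: cycle_word_def)
next
  case (step j)
  define p where "p i = (\<Prod>l=1..<i. A (v l) (v (Suc l)))" for i
  let ?x = "v (Suc j)"
  have S: "v i \<in> S" if "i < k" for i using chordless_cycle_in_S[OF c that] .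
  have ne: "v i \<noteq> ?x" if "i \<le> j" for i
    using chordless_cycle_neq[OF c, of i "Suc j"] that step(4) by simp
  have "pairing ?x (\<lambda>z. \<Sum>i=1..j. p i * basis (v i) z) = (\<Sum>i=1..j. p i * pairing ?x (basis (v i)))"
    by (rule pairing_combination) (use S step(4) in auto)
  also have "\<dots> = (\<Sum>i=1..j. if i = j then - (p j * A (v j) ?x) else 0)"
  proof (rule sum.cong)
    fix i assume i: "i \<in> {1..j}"
    have "A (v i) ?x = 0" if "i \<noteq> j"
      using chordless_cycle_nonadjacent[OF c, of i "Suc j"] i that step(4) by simp
    then show "p i * pairing ?x (basis (v i)) = (if i = j then - (p j * A (v j) ?x) else 0)"
      using ne[of i] i S[of i] step(4) A_sym[of ?x "v i"] by (auto simp: pairing_basis)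
  qed simp
  also have "\<dots> = - p (Suc j)" using step(1) by (simp add: p_def)
  finally have "reflect ?x (\<lambda>z. \<Sum>i=1..j. p i * basis (v i) z) =
      (\<lambda>z. \<Sum>i=1..Suc j. p i * basis (v i) z)"
    by (simp add: reflect_def)
  moreover have "cycle_word v (Suc j) = ?x # cycle_word v j"
    using step(1) by (simp add: cycle_word_def)
  moreover have "act (cycle_word v j) (basis (v 1)) = (\<lambda>z. \<Sum>i=1..j. p i * basis (v i) z)"
    using step(3,4) by (simp add: p_def)
  ultimately show ?case unfolding p_def by simp
qed

text \<open>The only neighbours of \<open>v 0\<close> on the cycle are \<open>v 1\<close> and
  \<open>v (k - 1)\<close>, distinct because \<open>3 \<le> k\<close>. They contribute the edge to
  \<open>v 1\<close> and the path around the rest of the cycle, so the pairing vanishes for weight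
  -1 and is 2 or -2 for weight 1.\<close>

lemma cycle_root_pairing:
  assumes c: "chordless_cycle A v k"
  defines "\<beta> \<equiv> act (cycle_word v (k - 1)) (basis (v 1))"
  shows "\<beta> (v 0) = 0"
    and "pairing (v 0) \<beta> = - A (v 0) (v 1) * (1 + (\<Prod>i<k. A (v i) (v (Suc i))))"
proof -
  define p where "p i = (\<Prod>l=1..<i. A (v l) (v (Suc l)))" for i
  have k: "3 \<le> k" and vk: "v k = v 0" using c by (auto simp: chordless_cycle_def)
  have S: "v i \<in> S" if "i < k" for i using chordless_cycle_in_S[OF c that] .
  have \<beta>: "\<beta> = (\<lambda>z. \<Sum>i=1..k-1. p i * basis (v i) z)"
    using cycle_root[OF c, of "k - 1"] k by (simp add: \<beta>_def p_def)
  have ne: "v i \<noteq> v 0" if "0 < i" "i < k" for i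
    using chordless_cycle_neq[OF c that] by simp
  have b0: "basis (v i) (v 0) = 0" if "0 < i" "i < k" for i using ne[OF that] by simp
  show "\<beta> (v 0) = 0" using b0 by (auto simp: \<beta> intro!: sum.neutral)
  have "pairing (v 0) \<beta> = (\<Sum>i=1..k-1. p i * pairing (v 0) (basis (v i)))"
    unfolding \<beta> by (rule pairing_combination) (use S in auto)
  also have "\<dots> = (\<Sum>i=1..k-1. - (p i * A (v 0) (v i)))"
    using S b0 by (intro sum.cong) (auto simp: pairing_basis)
  also have "\<dots> = (\<Sum>i\<in>{1, k-1}. - (p i * A (v 0) (v i)))"
  proof (rule sum.mono_neutral_right)
    have "A (v 0) (v i) = 0" if "1 \<le> i" "i \<le> k - 1" "i \<noteq> 1" "i \<noteq> k - 1" for i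
      using chordless_cycle_nonadjacent[OF c, of 0 i] that k by simp
    then show "\<forall>i\<in>{1..k-1} - {1, k-1}. - (p i * A (v 0) (v i)) = 0" by simp
  qed (use k in auto)
  also have "\<dots> = - A (v 0) (v 1) - p (k - 1) * A (v 0) (v (k - 1))"
    using k by (simp add: p_def)
  \<comment> \<open>The factor \<open>A (v 0) (v 1)\<close> squares to 1 against the first edge of
    the weight; the path from \<open>v 1\<close> and the closing edge to \<open>v k = v 0\<close>
    remain.\<close>
  also have "p (k - 1) * A (v 0) (v (k - 1)) = A (v 0) (v 1) * (\<Prod>i<k. A (v i) (v (Suc i)))"
  proof -
    have "{..<k} = insert 0 (insert (k - 1) {1..<k - 1})" using k by auto
    then have "(\<Prod>i<k. A (v i) (v (Suc i))) =
        A (v 0) (v 1) * (A (v (k - 1)) (v (Suc (k - 1))) * p (k - 1))"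
      using k by (simp add: p_def)
    also have "Suc (k - 1) = k" using k by simp
    finally have "A (v 0) (v 1) * (\<Prod>i<k. A (v i) (v (Suc i))) =
        (A (v 0) (v 1) * A (v 0) (v 1)) * (p (k - 1) * A (v 0) (v (k - 1)))"
      using vk A_sym[of "v (k - 1)" "v 0"] by (simp only: mult_ac)
    moreover have "A (v 0) (v 1) \<noteq> 0" using c k by (auto simp: chordless_cycle_def)
    ultimately show ?thesis using A_square by simp
  qed
  finally show "pairing (v 0) \<beta> = - A (v 0) (v 1) * (1 + (\<Prod>i<k. A (v i) (v (Suc i))))"
    by (simp add: algebra_simps)
qed

lemma cycle_reflection_in_S:
  assumes "chordless_cycle A v k"
  shows "set (cycle_reflection v k) \<subseteq> S" "v 0 \<in> S"
proof -
  have "3 \<le> k" using assms by (simp add: chordless_cycle_def)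
  then show "set (cycle_reflection v k) \<subseteq> S" "v 0 \<in> S"
    using chordless_cycle_in_S[OF assms] by (auto simp: cycle_reflection_def cycle_word_def)
qed

lemma act_cycle_reflection:
  assumes "chordless_cycle A v k"
  defines "\<beta> \<equiv> act (cycle_word v (k - 1)) (basis (v 1))"
  shows "act (cycle_reflection v k) u = (\<lambda>z. u z - form \<beta> u * \<beta> z)"
  using cycle_reflection_in_S[OF assms(1)]
  unfolding cycle_reflection_def \<beta>_def by (intro act_conjugate) auto

text \<open>Reflections in orthogonal roots commute: reflecting in \<open>v 0\<close> fixes \<beta>
  and leaves \<open>form \<beta>\<close> unchanged.\<close>

lemma unbalanced_cycle_commutes:
  assumes c: "chordless_cycle A v k" and w: "(\<Prod>i<k. A (v i) (v (Suc i))) = -1"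
  shows "act (v 0 # cycle_reflection v k) u = act (cycle_reflection v k @ [v 0]) u"
proof -
  define \<beta> where "\<beta> = act (cycle_word v (k - 1)) (basis (v 1))"
  have S: "v 0 \<in> S" using cycle_reflection_in_S[OF c] by simp
  have p: "pairing (v 0) \<beta> = 0" using cycle_root_pairing[OF c] w by (simp add: \<beta>_def)
  have f: "form \<beta> (reflect (v 0) u) = form \<beta> u"
    using p S by (simp add: reflect_def form_commute[of \<beta>] form_diff form_basis)
  have t: "act (cycle_reflection v k) u = (\<lambda>z. u z - form \<beta> u * \<beta> z)" for u
    unfolding \<beta>_def by (rule act_cycle_reflection[OF c])
  have r: "reflect (v 0) \<beta> = \<beta>" using p by (simp add: fun_eq_iff reflect_apply)
  have "reflect (v 0) (act (cycle_reflection v k) u) =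
      (\<lambda>z. reflect (v 0) u z - form \<beta> u * reflect (v 0) \<beta> z)"
    by (simp only: t reflect_diff)
  also have "\<dots> = act (cycle_reflection v k) (reflect (v 0) u)"
    by (simp only: t f r)
  finally show ?thesis by (simp only: foldr.simps foldr_append comp_apply id_apply)
qed

text \<open>Now the pairing is -2. Both sides are evaluated on the simple root of \<open>v 0\<close>
  and compared at coordinate \<open>v 0\<close>, where \<beta> vanishes; the values are 3 and
  -1.\<close>

lemma positive_cycle_not_commutes:
  assumes c: "chordless_cycle A v k" and nonneg: "\<And>x y. 0 \<le> A x y"
  shows "act (v 0 # cycle_reflection v k) \<noteq> act (cycle_reflection v k @ [v 0])"
proof
  assume eq: "act (v 0 # cycle_reflection v k) = act (cycle_reflection v k @ [v 0])"
  define \<beta> where "\<beta> = act (cycle_word v (k - 1)) (basis (v 1))"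
  have S: "v 0 \<in> S" using cycle_reflection_in_S[OF c] by simp
  have one: "A (v i) (v (Suc i)) = 1" if "i < k" for i
  proof -
    have "A (v i) (v (Suc i)) \<noteq> 0" using c that by (simp add: chordless_cycle_def)
    then show ?thesis
      using nonneg[of "v i" "v (Suc i)"] A_cases[of "v i" "v (Suc i)"] by linarith
  qed
  have "3 \<le> k" using c by (simp add: chordless_cycle_def)
  then have "A (v 0) (v 1) = 1" using one[of 0] by simp
  moreover have "(\<Prod>i<k. A (v i) (v (Suc i))) = 1" using one by (intro prod.neutral) simp
  ultimately have p: "pairing (v 0) \<beta> = -2"
    using cycle_root_pairing(2)[OF c] unfolding \<beta>_def by simp
  have z: "\<beta> (v 0) = 0" using cycle_root_pairing(1)[OF c] unfolding \<beta>_def .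
  have f: "form \<beta> (basis (v 0)) = -2" using p form_basis[OF S, of \<beta>] form_commute by simp
  have "form (\<lambda>z. - basis (v 0) z) \<beta> = 2"
    using p form_basis[OF S, of \<beta>] by (simp add: form_def sum_negf)
  then have f': "form \<beta> (\<lambda>z. - basis (v 0) z) = 2" using form_commute by simp
  have t: "act (cycle_reflection v k) u = (\<lambda>z. u z - form \<beta> u * \<beta> z)" for u
    unfolding \<beta>_def by (rule act_cycle_reflection[OF c])
  have "act (cycle_reflection v k) (basis (v 0)) = (\<lambda>z. basis (v 0) z - (-2) * \<beta> z)"
    unfolding t f ..
  then have 1: "act (v 0 # cycle_reflection v k) (basis (v 0)) =
      reflect (v 0) (\<lambda>z. basis (v 0) z - (-2) * \<beta> z)" by simp
  have "pairing (v 0) (\<lambda>z. basis (v 0) z - (-2) * \<beta> z) = -2"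
    unfolding pairing_diff pairing_basis[OF S] p by simp
  then have 3: "act (v 0 # cycle_reflection v k) (basis (v 0)) (v 0) = 3"
    unfolding 1 reflect_apply using z by simp
  have 2: "act (cycle_reflection v k @ [v 0]) (basis (v 0)) =
      act (cycle_reflection v k) (\<lambda>z. - basis (v 0) z)"
    by (simp add: reflect_basis_self[OF S])
  have "act (cycle_reflection v k @ [v 0]) (basis (v 0)) (v 0) = -1"
    unfolding 2 t using z by simp
  with 3 show False unfolding eq by simp
qed

end


section \<open>The signed Coxeter graph and its representation\<close>

definition adjacency :: "'a set \<Rightarrow> ('a \<Rightarrow> 'a \<Rightarrow> enat) \<Rightarrow> ('a set \<Rightarrow> int) \<Rightarrow> 'a \<Rightarrow> 'a \<Rightarrow> int" where
  "adjacency S m f x y = (if {x, y} \<in> coxeter_edges S m then f {x, y} else 0)"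

lemma simply_laced_signing_adjacency:
  assumes W: "coxeter_system W S m" and sl: "simply_laced S m"
    and f: "f \<in> coxeter_edges S m \<rightarrow> {1, -1}"
  shows "simply_laced_signing S m (adjacency S m f)"
proof
  show "finite S" using W by (simp add: coxeter_system_def)
  fix x y
  show "adjacency S m f x y = adjacency S m f y x" by (simp add: adjacency_def insert_commute)
  show "adjacency S m f x x = 0" using coxeter_edge_iff[of x x S m] by (simp add: adjacency_def)
  show "x \<in> S" if "adjacency S m f x y \<noteq> 0"
    using that by (auto simp: adjacency_def coxeter_edge_iff split: if_splits)
  assume xy: "x \<in> S" "y \<in> S" "x \<noteq> y"
  have sm: "m y x = m x y" using W xy by (simp add: coxeter_system_def)
  have "m x y = 2 \<or> m x y = 3" using sl xy by (simp add: simply_laced_def)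
  moreover have "\<not> (3::enat) \<le> 2" by (simp add: numeral_eq_enat)
  ultimately show "m x y = 2 \<and> adjacency S m f x y = 0 \<or>
      m x y = 3 \<and> (adjacency S m f x y = 1 \<or> adjacency S m f x y = -1)"
    using xy sm f by (auto simp: adjacency_def coxeter_edge_iff Pi_def)
qed

section \<open>Switching signs by a diagonal matrix\<close>

lemma simply_laced_signing_abs:
  assumes "simply_laced_signing S m A" shows "simply_laced_signing S m (\<lambda>x y. \<bar>A x y\<bar>)"
proof -
  interpret simply_laced_signing S m A by fact
  show ?thesis
  proof
    fix x y
    show "\<bar>A x y\<bar> = \<bar>A y x\<bar>" using A_sym[of x y] by simp
    show "x \<in> S" if "\<bar>A x y\<bar> \<noteq> 0" using that A_support by auto
    assume "x \<in> S" "y \<in> S" "x \<noteq> y"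
    from A_order[OF this]
    show "m x y = 2 \<and> \<bar>A x y\<bar> = 0 \<or> m x y = 3 \<and> (\<bar>A x y\<bar> = 1 \<or> \<bar>A x y\<bar> = -1)" by auto
  qed (use finite_S in auto)
qed

text \<open>Scaling coordinates by \<epsilon> intertwines the two matrices because
  \<open>\<epsilon> x * A x y = \<bar>A x y\<bar> * \<epsilon> y\<close>, so every single reflection
  is intertwined.\<close>

lemma act_switch:
  assumes A: "simply_laced_signing S m A"
    and \<epsilon>: "\<And>x. \<epsilon> x * \<epsilon> x = (1::int)" "\<And>x y. A x y = \<epsilon> x * \<epsilon> y * \<bar>A x y\<bar>"
  shows "simply_laced_signing.act S (\<lambda>x y. \<bar>A x y\<bar>) xs (\<lambda>z. \<epsilon> z * v z) =
    (\<lambda>z. \<epsilon> z * simply_laced_signing.act S A xs v z)"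
proof -
  interpret simply_laced_signing S m A by fact
  interpret abs: simply_laced_signing S m "\<lambda>x y. \<bar>A x y\<bar>" using simply_laced_signing_abs[OF A] .
  have "\<epsilon> x * A x y = \<bar>A x y\<bar> * \<epsilon> y" for x y
    by (subst \<epsilon>(2)) (use \<epsilon>(1)[of x] in \<open>simp add: mult.assoc[symmetric]\<close>)
  then have "(\<Sum>y\<in>S. \<bar>A x y\<bar> * (\<epsilon> y * u y)) = \<epsilon> x * (\<Sum>y\<in>S. A x y * u y)" for x u
    by (simp add: sum_distrib_left flip: mult.assoc)
  then have "abs.pairing x (\<lambda>z. \<epsilon> z * u z) = \<epsilon> x * pairing x u" for x u
    by (simp add: abs.pairing_def pairing_def right_diff_distrib)
  then have "abs.reflect x (\<lambda>z. \<epsilon> z * u z) = (\<lambda>z. \<epsilon> z * reflect x u z)" for x u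
    by (auto simp: fun_eq_iff abs.reflect_apply reflect_apply basis_def right_diff_distrib)
  then show ?thesis by (induction xs) simp_all
qed

lemma balanced_iff_walk:
  assumes "simply_laced_signing S m (adjacency S m f)"
    and f: "f \<in> coxeter_edges S m \<rightarrow> {1, -1}"
  shows "balanced (coxeter_graph S m) f \<longleftrightarrow>
    (\<forall>x k \<sigma>. simply_laced_signing.walk (adjacency S m f) x x k \<sigma> \<longrightarrow> \<sigma> = 1)"
proof -
  interpret simply_laced_signing S m "adjacency S m f" by fact
  interpret G: wf_digraph "coxeter_graph S m" by (rule wf_coxeter_graph)
  have sel: "verts (coxeter_graph S m) = S" "arcs (coxeter_graph S m) = {(x, y). {x, y} \<in> coxeter_edges S m}"
    "tail (coxeter_graph S m) = fst" "head (coxeter_graph S m) = snd"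
    by (auto simp: coxeter_graph_def)
  have edge: "{x, y} \<in> coxeter_edges S m \<longleftrightarrow> adjacency S m f x y \<noteq> 0" for x y
    using f by (auto simp: adjacency_def Pi_def)
  have to_awalk: "\<exists>p. G.awalk x p y \<and> path_weight f p = \<sigma>" if "walk x y k \<sigma>" "x \<in> S" for x y k \<sigma>
    using that
  proof (induction rule: walk.induct)
    case (Nil x)
    then show ?case by (intro exI[of _ "[]"]) (auto simp: G.awalk_Nil_iff sel path_weight_def)
  next
    case (snoc x y k \<sigma> z)
    then obtain p where p: "G.awalk x p y" "path_weight f p = \<sigma>" by auto
    have e: "{y, z} \<in> coxeter_edges S m" using snoc edge by simp
    then have "G.awalk y [(y, z)] z" by (auto simp: G.awalk_def sel coxeter_edge_iff)
    then have "G.awalk x (p @ [(y, z)]) z" using p by (blast intro: G.awalk_appendI)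
    then show ?case using p e
      by (intro exI[of _ "p @ [(y, z)]"]) (auto simp: path_weight_def adjacency_def)
  qed
  have from_awalk: "\<exists>k. walk x y k (path_weight f p)" if "G.awalk x p y" for x p y
    using that
  proof (induction p arbitrary: x)
    case Nil
    then show ?case using walk.Nil by (auto simp: G.awalk_Nil_iff path_weight_def)
  next
    case (Cons e p)
    then obtain z where e: "e = (x, z)" "{x, z} \<in> coxeter_edges S m" "G.awalk z p y"
      by (cases e) (auto simp: G.awalk_Cons_iff sel)
    then obtain k where "walk z y k (path_weight f p)" using Cons by blast
    then have "walk x y (1 + k) (adjacency S m f x z * path_weight f p)"
      using walk_edge[of x z] e edge by (blast intro: walk_append)
    moreover have "adjacency S m f x z * path_weight f p = path_weight f (e # p)"
      using e by (simp add: path_weight_def adjacency_def)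
    ultimately show ?case by metis
  qed
  show ?thesis
  proof (intro iffI allI impI)
    fix x k \<sigma> assume bal: "balanced (coxeter_graph S m) f" and w: "walk x x k \<sigma>"
    show "\<sigma> = 1"
    proof (cases "x \<in> S")
      case True
      then obtain p where "G.awalk x p x" "path_weight f p = \<sigma>" using to_awalk w by blast
      then show ?thesis using bal
        by (cases "p = []") (auto simp: balanced_def G.closed_w_def path_weight_def)
    next
      \<comment> \<open>No edge leaves a point outside \<open>S\<close>, so only the empty walk
        starts there.\<close>
      case False
      have "y = x \<and> \<sigma> = 1" if "walk x y k \<sigma>" for y k \<sigma>
        using that False by (induction rule: walk.induct) (auto dest: A_support)
      then show ?thesis using w by blast
    qed
  next
    assume walks: "\<forall>x k \<sigma>. walk x x k \<sigma> \<longrightarrow> \<sigma> = 1"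
    show "balanced (coxeter_graph S m) f"
      unfolding balanced_def
    proof (intro allI impI)
      fix p assume "G.closed_w p"
      then obtain u where "G.awalk u p u" by (auto simp: G.closed_w_def)
      then show "path_weight f p = 1" using from_awalk walks by blast
    qed
  qed
qed

text \<open>The link between complex matrices and integer vectors, one column at a time:
  \<open>v\<close>, read along the enumeration \<open>s\<close>, is column \<open>l\<close> of
  \<open>M\<close>.\<close>

lemma signed_gen_mult:
  assumes M: "M \<in> carrier_mat (card S) (card S)"
    and s: "bij_betw s {..<card S} S" and col: "\<And>k. k < card S \<Longrightarrow> M $$ (k, l) = of_int (v (s k))"
    and ikl: "i < card S" "k < card S" "l < card S"
    and signing: "simply_laced_signing S m (adjacency S m f)"
  shows "(signed_gen S m s f i * M) $$ (k, l) =
    of_int (simply_laced_signing.reflect S (adjacency S m f) (s i) v (s k))"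
proof -
  interpret simply_laced_signing S m "adjacency S m f" by fact
  let ?n = "card S" and ?A = "adjacency S m f"
  have inj: "s j = s k \<longleftrightarrow> j = k" if "j < ?n" "k < ?n" for j k
    using bij_betw_imp_inj_on[OF s] that by (auto simp: inj_on_def)
  have "(signed_gen S m s f i * M) $$ (k, l) = (\<Sum>j<?n. signed_gen S m s f i $$ (k, j) * M $$ (j, l))"
    using M ikl by (auto simp: scalar_prod_def atLeast0LessThan signed_gen_def)
  \<comment> \<open>The generator is the identity plus, in row \<open>i\<close>, the row of
    \<open>A - 2 I\<close>; on the diagonal this gives 0 - 2 + 1 = -1.\<close>
  also have "\<dots> = (\<Sum>j<?n. of_int (((if k = i then ?A (s i) (s j) - 2 * basis i j else 0) + basis k j) * v (s j)))"
    using ikl col coxeter_edge_iff[of _ _ S m]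
    by (intro sum.cong) (auto simp: signed_gen_def basis_def adjacency_def)
  also have "\<dots> = of_int (\<Sum>j<?n. ((if k = i then ?A (s i) (s j) - 2 * basis i j else 0) + basis k j) * v (s j))"
    by simp
  also have "(\<Sum>j<?n. ((if k = i then ?A (s i) (s j) - 2 * basis i j else 0) + basis k j) * v (s j)) =
      reflect (s i) v (s k)"
  proof -
    have delta: "(\<Sum>j<?n. basis k j * v (s j)) = v (s k)" if "k < ?n" for k
      using that by (simp add: basis_def if_distrib[of "\<lambda>a. a * _"] cong: if_cong)
    have row: "(\<Sum>j<?n. ?A (s i) (s j) * v (s j)) = (\<Sum>y\<in>S. ?A (s i) y * v y)"
      by (rule sum.reindex_bij_betw[OF s])
    show ?thesis
    proof (cases "k = i")
      case True
      have "(\<Sum>j<?n. (?A (s i) (s j) - 2 * basis i j + basis k j) * v (s j)) =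
          (\<Sum>j<?n. ?A (s i) (s j) * v (s j)) - (\<Sum>j<?n. basis i j * v (s j))"
        using True by (simp add: algebra_simps sum_subtractf sum.distrib sum_distrib_left)
      then show ?thesis using True ikl delta row by (simp add: reflect_def pairing_def basis_def)
    next
      case False
      then show ?thesis using ikl delta inj by (simp add: reflect_def basis_def)
    qed
  qed
  finally show ?thesis .
qed

theorem theorem4p6:
  fixes W :: "('a, 'm) monoid_scheme"
    and S :: "'a set"
    and m :: "'a \<Rightarrow> 'a \<Rightarrow> enat"
    and s :: "nat \<Rightarrow> 'a"
    and f :: "'a set \<Rightarrow> int"
  assumes "coxeter_system W S m"
    and "simply_laced S m"
    and "bij_betw s {..<card S} S"
    and "f \<in> coxeter_edges S m \<rightarrow> {1, -1}"
  shows "inj_on (signed_rep W S m s f) (carrier W) \<longleftrightarrow> balanced (coxeter_graph S m) f"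
proof -
  let ?n = "card S" and ?\<rho> = "signed_rep W S m s f" and ?A = "adjacency S m f"
  have signing: "simply_laced_signing S m ?A" using simply_laced_signing_adjacency assms by blast
  interpret simply_laced_signing S m ?A by (rule signing)
  \<comment> \<open>The geometric representation of the same group: all edge signs are replaced by
    +1.\<close>
  interpret abs: simply_laced_signing S m "\<lambda>x y. \<bar>?A x y\<bar>"
    using simply_laced_signing_abs[OF signing] .
  have pres: "group_presentation W S (coxeter_relators S m)"
    using assms(1) by (simp add: coxeter_system_def)
  interpret W: group W using pres by (simp add: group_presentation_def)
  interpret GL: group "GL ?n" by (rule GL_simps)
  have SW: "S \<subseteq> carrier W" and gen: "generate W S = carrier W"
    using pres by (auto simp: group_presentation_def)
  define ev where "ev xs = word_eval W (\<lambda>x. x) (pos xs)" for xs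
  have ev_eq: "ev xs = ev ys \<longleftrightarrow> weq (pos xs) (pos ys)" if "set xs \<subseteq> S" "set ys \<subseteq> S" for xs ys
    using pres that unfolding ev_def group_presentation_def by simp
  have ev_closed: "ev xs \<in> carrier W" if "set xs \<subseteq> S" for xs
    unfolding ev_def using that SW by (intro W.word_eval_closed[of _ S]) auto
  have ev_surj: "\<exists>xs. set xs \<subseteq> S \<and> ev xs = g" if g: "g \<in> carrier W" for g
  proof -
    obtain u where u: "u \<in> gwords S" "word_eval W (\<lambda>x. x) u = g"
      using W.word_eval_surj[OF SW] g gen by blast
    have "set (map fst u) \<subseteq> S" using u by (auto simp: gwords_def)
    moreover from this have "ev (map fst u) = g"
      using weq_pos_all[OF u(1)] pres u unfolding ev_def group_presentation_def by (metis pos_gwords)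
    ultimately show ?thesis by blast
  qed
  have hom: "?\<rho> \<in> hom W (GL ?n)" and gens: "\<And>i. i < ?n \<Longrightarrow> ?\<rho> (s i) = signed_gen S m s f i"
    using signed_rep[OF assms] by auto
  have sS: "s i \<in> S" if "i < ?n" for i using assms(3) that by (auto simp: bij_betw_def)
  have s_onto: "\<exists>i<?n. x = s i" if "x \<in> S" for x using assms(3) that by (auto simp: bij_betw_def)
  have inj: "s j = s k \<longleftrightarrow> j = k" if "j < ?n" "k < ?n" for j k
    using bij_betw_imp_inj_on[OF assms(3)] that by (auto simp: inj_on_def)
  \<comment> \<open>Column \<open>l\<close> of the matrix of a word is the image of the simple root
    of \<open>s l\<close> under the word.\<close>
  have \<rho>: "?\<rho> (ev xs) \<in> carrier_mat ?n ?n \<and>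
      (\<forall>k<?n. \<forall>l<?n. ?\<rho> (ev xs) $$ (k, l) = of_int (act xs (basis (s l)) (s k)))"
    if "set xs \<subseteq> S" for xs
    using that
  proof (induction xs)
    case Nil
    have "?\<rho> (ev []) = 1\<^sub>m ?n"
      using hom_one[OF hom W.is_group GL.is_group] by (simp add: ev_def GL_simps)
    then show ?case using inj by (auto simp: basis_def)
  next
    case (Cons x xs)
    then have x: "x \<in> S" and xs: "set xs \<subseteq> S" and IH: "?\<rho> (ev xs) \<in> carrier_mat ?n ?n"
      "\<And>k l. k < ?n \<Longrightarrow> l < ?n \<Longrightarrow> ?\<rho> (ev xs) $$ (k, l) = of_int (act xs (basis (s l)) (s k))"
      by auto
    obtain i where i: "i < ?n" "x = s i" using s_onto x by blast
    have "?\<rho> (ev (x # xs)) = signed_gen S m s f i * ?\<rho> (ev xs)"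
      using hom_mult[OF hom _ ev_closed[OF xs], of x] x SW i gens by (auto simp: ev_def GL_simps)
    moreover have "(signed_gen S m s f i * ?\<rho> (ev xs)) $$ (k, l) =
        of_int (act (x # xs) (basis (s l)) (s k))" if "k < ?n" "l < ?n" for k l
      using signed_gen_mult[OF IH(1) assms(3), of l "act xs (basis (s l))"] IH(2) that i signing by simp
    moreover have "signed_gen S m s f i \<in> carrier_mat ?n ?n" by (simp add: signed_gen_def)
    ultimately show ?case using IH(1) by simp
  qed
  have \<rho>_eq: "?\<rho> (ev xs) = ?\<rho> (ev ys) \<longleftrightarrow>
      (\<forall>x\<in>S. \<forall>z\<in>S. act xs (basis x) z = act ys (basis x) z)" (is "?L = ?R")
    if S: "set xs \<subseteq> S" "set ys \<subseteq> S" for xs ys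
  proof
    assume ?L
    show ?R
    proof (intro ballI)
      fix x z assume "x \<in> S" "z \<in> S"
      then obtain l k where "l < ?n" "x = s l" "k < ?n" "z = s k" using s_onto by blast
      then show "act xs (basis x) z = act ys (basis x) z"
        using \<rho>[OF S(1)] \<rho>[OF S(2)] \<open>?L\<close> by (metis of_int_eq_iff)
    qed
  next
    assume ?R
    then show ?L using \<rho>[OF S(1)] \<rho>[OF S(2)] sS by (intro eq_matI) auto
  qed
  show ?thesis unfolding balanced_iff_walk[OF signing assms(4)]
  proof
    assume inj: "inj_on ?\<rho> (carrier W)"
    show "\<forall>x k \<sigma>. walk x x k \<sigma> \<longrightarrow> \<sigma> = 1"
    proof (rule ccontr)
      assume "\<not> ?thesis"
      then obtain x l where "walk x x l (-1)" using walk_sign by blast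
      then obtain v k where c: "chordless_cycle ?A v k"
        and w: "(\<Prod>i<k. ?A (v i) (v (Suc i))) = -1" by (rule unbalanced_chordless_cycle)
      let ?xs = "v 0 # cycle_reflection v k" and ?ys = "cycle_reflection v k @ [v 0]"
      have S: "set ?xs \<subseteq> S" "set ?ys \<subseteq> S" using cycle_reflection_in_S[OF c] by auto
      have "?\<rho> (ev ?xs) = ?\<rho> (ev ?ys)"
        unfolding \<rho>_eq[OF S] unbalanced_cycle_commutes[OF c w] by simp
      then have "ev ?xs = ev ?ys" using inj ev_closed S by (auto simp: inj_on_def)
      \<comment> \<open>The equality now holds in \<open>W\<close> itself, so the two words also act
        equally with all signs +1.\<close>
      then have "abs.act ?xs = abs.act ?ys" using ev_eq S abs.weq_pos_act by blast
      \<comment> \<open>\<open>chordless_cycle\<close> sees only which entries of the matrix are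
        nonzero, so the same cycle is chordless for the absolute values.\<close>
      moreover have "abs.act ?xs \<noteq> abs.act ?ys"
        using abs.positive_cycle_not_commutes[of v k] c
        by (simp add: chordless_cycle_def)
      ultimately show False by blast
    qed
  next
    assume "\<forall>x k \<sigma>. walk x x k \<sigma> \<longrightarrow> \<sigma> = 1"
    then obtain \<epsilon> where \<epsilon>: "\<And>x. \<epsilon> x * \<epsilon> x = 1" "\<And>x y. ?A x y = \<epsilon> x * \<epsilon> y * \<bar>?A x y\<bar>"
      using potential by metis
    have kernel: "ev xs = ev []" if xs: "set xs \<subseteq> S" and "?\<rho> (ev xs) = ?\<rho> (ev [])" for xs
    proof -
      have "act xs (basis x) x = 1" if "x \<in> S" for x
        using that \<rho>_eq[of xs "[]"] xs \<open>?\<rho> (ev xs) = ?\<rho> (ev [])\<close> by (simp add: basis_def)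
      \<comment> \<open>The two actions are conjugate by the diagonal matrix of \<epsilon>, so their
        diagonal entries agree; the factor \<open>\<epsilon> x\<close> occurs on both sides and
        cancels.\<close>
      moreover have "abs.act xs (basis x) x = act xs (basis x) x" for x
      proof -
        have e: "(\<lambda>z. \<epsilon> z * basis x z) = (\<lambda>z. 0 - (- \<epsilon> x) * basis x z)"
          by (auto simp: basis_def)
        have zero: "abs.act xs (\<lambda>z. 0) = (\<lambda>z. 0)"
          using abs.act_diff[of xs "\<lambda>z. 0" 1 "\<lambda>z. 0"] by simp
        have "(\<lambda>z. \<epsilon> z * act xs (basis x) z) = (\<lambda>z. 0 - (- \<epsilon> x) * abs.act xs (basis x) z)"
          unfolding act_switch[OF signing \<epsilon>, symmetric] e abs.act_diff zero ..
        from fun_cong[OF this, of x]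
        have "\<epsilon> x * act xs (basis x) x = \<epsilon> x * abs.act xs (basis x) x" by simp
        moreover have "\<epsilon> x \<noteq> 0" using \<epsilon>(1)[of x] by auto
        ultimately show ?thesis by simp
      qed
      ultimately have "weq (pos xs) (pos [])" by (intro abs.act_faithful xs) auto
      then show ?thesis using ev_eq[of xs "[]"] xs by simp
    qed
    interpret \<rho>: group_hom W "GL ?n" ?\<rho>
      using hom by (intro group_hom.intro group_hom_axioms.intro W.is_group GL.is_group)
    show "inj_on ?\<rho> (carrier W)"
    proof (rule \<rho>.inj_on_one_iff[THEN iffD2], intro allI impI)
      fix g assume "g \<in> carrier W" "?\<rho> g = \<one>\<^bsub>GL ?n\<^esub>"
      moreover obtain xs where "set xs \<subseteq> S" "ev xs = g" using ev_surj \<open>g \<in> carrier W\<close> by blast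
      moreover have "ev [] = \<one>\<^bsub>W\<^esub>" by (simp add: ev_def)
      ultimately show "g = \<one>\<^bsub>W\<^esub>" using kernel[of xs] \<rho>.hom_one by auto
    qed
  qed
qed

end
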